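(* For every non-negative integer $n$, $p_{2,3}(n)-p_{6,9}(n-2)$ equals the number of partitions of $n$ into parts $\equiv \pm1,\pm4,\pm6,\pm8,\pm10,\pm11 \pmod{24}$.
   Context: A partition of $n$ is a finite multiset of positive integers summing to $n$. For positive integers $A,a$ and a partition $\pi$, $\mathrm{mex}_{A,a}(\pi)$ is the smallest element of $\{a,a+A,a+2A,\dots\}$ that is not a part of $\pi$. $p_{A,a}(n)$ is the number of partitions $\pi$ of $n$ with $\mathrm{mex}_{A,a}(\pi)\equiv a \pmod{2A}$; by convention $p_{A,a}(0)=1$ and $p_{A,a}(m)=0$ for $m<0$. *)

theory Defs
  imports Main "HOL-Library.Multiset" "HOL-Number_Theory.Cong"
begin

definition partition_of :: "int \<Rightarrow> nat multiset \<Rightarrow> bool" where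
  "partition_of n \<pi> \<longleftrightarrow> (\<forall>x \<in># \<pi>. 0 < x) \<and> int (sum_mset \<pi>) = n"

text \<open>
  For positive \<open>A\<close> the progression is infinite and \<open>\<pi>\<close> is finite, so the least element exists.
\<close>
definition mex :: "nat \<Rightarrow> nat \<Rightarrow> nat multiset \<Rightarrow> nat" where
  "mex A a \<pi> = (LEAST m. m \<in> range (\<lambda>k. a + k * A) \<and> m \<notin># \<pi>)"

text \<open>
  The argument is an integer so that it may be negative. The conventions that the value is 1 at
  zero and 0 at negative arguments hold without a case distinction; see the two lemmas below.
\<close>
definition p_mex :: "nat \<Rightarrow> nat \<Rightarrow> int \<Rightarrow> nat" where
  "p_mex A a n = card {\<pi>. partition_of n \<pi> \<and> [mex A a \<pi> = a] (mod (2 * A))}"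

lemma p_mex_neg: "n < 0 \<Longrightarrow> p_mex A a n = 0"
  by (simp add: p_mex_def partition_of_def del: of_nat_sum_mset)

lemma p_mex_zero: "p_mex A a 0 = 1"
proof -
  have "partition_of 0 \<pi> \<longleftrightarrow> \<pi> = {#}" for \<pi>
    by (cases \<pi>) (auto simp: partition_of_def simp del: of_nat_sum_mset)
  moreover have "mex A a {#} = a"
    unfolding mex_def by (rule Least_equality) (auto intro: image_eqI[where x = 0])
  ultimately have "{\<pi>. partition_of 0 \<pi> \<and> [mex A a \<pi> = a] (mod (2 * A))} = {{#}}"
    by auto
  then show ?thesis
    by (simp add: p_mex_def)
qed

lemma finite_partitions: "finite {\<pi>. partition_of n \<pi>}"
proof -
  have *: "set_mset \<pi> \<subseteq> {..nat n} \<and> size \<pi> \<le> nat n" if "partition_of n \<pi>" for \<pi>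
  proof -
    have pos: "\<forall>x \<in># \<pi>. 0 < x" and s: "sum_mset \<pi> = nat n"
      using that by (auto simp: partition_of_def simp del: of_nat_sum_mset)
    have "x \<le> sum_mset \<pi>" if "x \<in># \<pi>" for x
      using that by (metis sum_mset.remove le_add1)
    moreover have "size \<pi> \<le> sum_mset \<pi>"
      using pos by (induction \<pi>) auto
    ultimately show ?thesis
      using s by auto
  qed
  have "{\<pi>. partition_of n \<pi>} \<subseteq> mset ` {xs. set xs \<subseteq> {..nat n} \<and> length xs \<le> nat n}"
  proof
    fix \<pi> assume "\<pi> \<in> {\<pi>. partition_of n \<pi>}"
    moreover obtain xs where "\<pi> = mset xs"
      by (metis ex_mset)
    ultimately show "\<pi> \<in> mset ` {xs. set xs \<subseteq> {..nat n} \<and> length xs \<le> nat n}"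
      using *[of \<pi>] by auto
  qed
  then show ?thesis
    by (rule finite_subset) (intro finite_imageI finite_lists_length_le finite_atMost)
qed

end

theory Submission
  imports Defs "HOL-Analysis.Analysis" "HOL-Real_Asymp.Real_Asymp"
begin

text \<open>
  Inclusion-exclusion over the initial segment of \<open>a, a + A, a + 2A, \<dots>\<close> contained in a partition
  gives \<open>\<Sum>n. p\<^bsub>A,a\<^esub>(n) q^n = (1 / (q;q)) \<Sum>j. (-1)^j q^(j a + A j (j - 1) / 2)\<close>. For \<open>(2, 3)\<close> and
  \<open>(6, 9)\<close> the exponents are \<open>(j + 1)^2 - 1\<close> and \<open>3 (j + 1)^2 - 3\<close>, so with
  \<open>\<phi>(-q) = \<Sum>j\<in>\<int>. (-1)^j q^(j^2)\<close> everything reduces to writing \<open>(\<phi>(-q^3) - \<phi>(-q)) / 2q\<close> as the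
  product of \<open>1 - q^n\<close> over the complementary residues \<open>0, 12, \<plusminus>2, \<plusminus>3, \<plusminus>5, \<plusminus>7, \<plusminus>9\<close> modulo 24.

  After division by \<open>(q^3;q^6)\<close>, both \<open>\<phi>(-q^3)\<close> and \<open>\<phi>(-q)\<close> become series over triangular numbers
  by the Jacobi triple product (at \<open>q^3\<close> and at a cube root of unity, respectively), and the
  difference of these two series is \<open>2q\<close> times an instance of the quintuple product.
\<close>

section \<open>Infinite q-products\<close>

definition qpoch :: "complex \<Rightarrow> complex \<Rightarrow> nat \<Rightarrow> complex" where
  "qpoch a q n = (\<Prod>k<n. 1 - a * q ^ k)"

text \<open>\<open>qpoch a q n\<close> is \<open>(a;q)\<^sub>n\<close> and \<open>qprod a q\<close> is \<open>(a;q)\<^sub>\<infinity>\<close>.\<close>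

definition qprod :: "complex \<Rightarrow> complex \<Rightarrow> complex" where
  "qprod a q = (\<Prod>k. 1 - a * q ^ k)"

lemma qpoch_0 [simp]: "qpoch a q 0 = 1"
  and qpoch_Suc: "qpoch a q (Suc n) = qpoch a q n * (1 - a * q ^ n)"
  by (simp_all add: qpoch_def)

lemma convergent_prod_q:
  assumes "norm q < 1"
  shows "convergent_prod (\<lambda>k. 1 - a * q ^ k :: complex)"
proof -
  have "summable (\<lambda>k. norm a * norm q ^ k)"
    using assms by (intro summable_mult summable_geometric) auto
  then have "abs_convergent_prod (\<lambda>k. 1 - a * q ^ k)"
    by (simp add: abs_convergent_prod_conv_summable norm_mult norm_power)
  then show ?thesis
    by (rule abs_convergent_prod_imp_convergent_prod)
qed

lemma qpoch_tendsto: "norm q < 1 \<Longrightarrow> qpoch a q \<longlonglongrightarrow> qprod a q"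
  unfolding qpoch_def qprod_def
  by (intro has_prod_imp_tendsto' convergent_prod_has_prod convergent_prod_q)

lemma qprod_nonzero:
  assumes "norm q < 1" "\<And>k. a * q ^ k \<noteq> 1"
  shows "qprod a q \<noteq> 0"
  unfolding qprod_def using assms
  by (intro prodinf_nonzero convergent_prod_q) auto

lemma power_neq_1:
  fixes q :: complex
  assumes "norm q < 1" "m > 0"
  shows "q ^ m \<noteq> 1"
proof
  assume "q ^ m = 1"
  then have "norm q ^ m = 1" by (metis norm_one norm_power)
  with assms show False
    by (metis norm_ge_zero power_less_one_iff order_less_irrefl)
qed

lemma norm_power_lt_1:
  fixes q :: "'a::real_normed_div_algebra"
  assumes "norm q < 1" "m > 0"
  shows "norm (q ^ m) < 1"
  using assms by (simp add: norm_power power_less_one_iff)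

lemma qprod_power_nonzero:
  assumes "norm q < 1" "m > 0" "l > 0"
  shows "qprod (q ^ m) (q ^ l) \<noteq> 0"
  using assms
    by (intro qprod_nonzero norm_power_lt_1)
       (use power_neq_1[of q "m + l * _"] in \<open>auto simp: power_add power_mult\<close>)

text \<open>Sorts the factors by \<open>k mod m\<close>. For \<open>n * m\<close> factors this is an
  exact finite rearrangement; the limit is then taken along the subsequence
  \<open>n * m\<close>.\<close>

lemma qprod_dissect:
  assumes "norm q < 1" "m > 0"
  shows "qprod a q = (\<Prod>j<m. qprod (a * q ^ j) (q ^ m))"
proof -
  have "qpoch a q (n * m) = (\<Prod>j<m. qpoch (a * q ^ j) (q ^ m) n)" for n
  proof -
    have block: "(\<Prod>k=i*m..<i*m+m. 1 - a * q ^ k) = (\<Prod>j<m. 1 - a * q ^ j * (q ^ m) ^ i)" for i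
      using prod.atLeastLessThan_shift_bounds[of "\<lambda>k. 1 - a * q ^ k" 0 "i*m" m]
      by (simp add: lessThan_atLeast0 o_def power_add add.commute[of m] mult_ac flip: power_mult)
    have "qpoch a q (n * m) = (\<Prod>i<n. \<Prod>j<m. 1 - a * q ^ j * (q ^ m) ^ i)"
      unfolding qpoch_def block [symmetric] by (rule prod.nat_group [symmetric])
    also have "\<dots> = (\<Prod>j<m. qpoch (a * q ^ j) (q ^ m) n)"
      unfolding qpoch_def by (rule prod.swap)
    finally show ?thesis .
  qed
  moreover have "(\<lambda>n. \<Prod>j<m. qpoch (a * q ^ j) (q ^ m) n) \<longlonglongrightarrow> (\<Prod>j<m. qprod (a * q ^ j) (q ^ m))"
    using assms by (intro tendsto_prod qpoch_tendsto norm_power_lt_1)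
  moreover have "(\<lambda>n. qpoch a q (n * m)) \<longlonglongrightarrow> qprod a q"
    using LIMSEQ_subseq_LIMSEQ[OF qpoch_tendsto[OF assms(1)], of "\<lambda>n. n * m" a] assms(2)
    by (simp add: strict_mono_def o_def)
  ultimately show ?thesis
    by (simp add: LIMSEQ_unique)
qed

lemma qprod_diff_squares:
  assumes "norm q < 1"
  shows "qprod a q * qprod (- a) q = qprod (a\<^sup>2) (q\<^sup>2)"
proof -
  have "qpoch a q n * qpoch (- a) q n = qpoch (a\<^sup>2) (q\<^sup>2) n" for n
  proof -
    have "(1 - a * q ^ k) * (1 - (- a) * q ^ k) = 1 - a\<^sup>2 * (q\<^sup>2) ^ k" for k
    proof -
      have "(1 - a * q ^ k) * (1 - (- a) * q ^ k) = 1 - a\<^sup>2 * (q ^ k)\<^sup>2"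
        by (simp add: algebra_simps power2_eq_square)
      then show ?thesis by (simp add: power_mult [symmetric] mult.commute)
    qed
    then show ?thesis
      by (simp only: qpoch_def prod.distrib [symmetric])
  qed
  moreover have "(\<lambda>n. qpoch a q n * qpoch (- a) q n) \<longlonglongrightarrow> qprod a q * qprod (- a) q"
    using assms by (intro tendsto_mult qpoch_tendsto)
  moreover have "qpoch (a\<^sup>2) (q\<^sup>2) \<longlonglongrightarrow> qprod (a\<^sup>2) (q\<^sup>2)"
    using assms by (intro qpoch_tendsto norm_power_lt_1) auto
  ultimately show ?thesis
    by (simp add: LIMSEQ_unique)
qed

section \<open>Gaussian binomial coefficients and the q-binomial theorem\<close>

text \<open>The Gaussian binomial coefficient, as a quotient so that its limit in \<open>n\<close>
  is immediate. For \<open>k > n\<close> and \<open>norm q < 1\<close> the truncated subtraction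
  gives a nonzero value instead of the customary 0.\<close>

definition qbin :: "complex \<Rightarrow> nat \<Rightarrow> nat \<Rightarrow> complex" where
  "qbin q n k = qpoch q q n / (qpoch q q k * qpoch q q (n - k))"

lemma qpoch_nonzero: "norm q < 1 \<Longrightarrow> qpoch q q n \<noteq> 0"
  using power_neq_1[of q "Suc _"] by (auto simp: qpoch_def)

text \<open>The q-Pascal rule. With \<open>X = q ^ k\<close>, \<open>Y = q ^ d\<close> and
  \<open>n = k + d + 1\<close>, clearing denominators leaves 1 - q^2 X Y = (1 - q Y) + q Y (1 - q
  X).\<close>

lemma qbin_pascal:
  assumes q: "norm q < 1" and "k < n"
  shows "qbin q (Suc n) (Suc k) = qbin q n (Suc k) + q ^ (n - k) * qbin q n k"
proof -
  obtain d where n: "n = Suc (k + d)"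
    using \<open>k < n\<close> less_iff_Suc_add by auto
  have nz: "qpoch q q i \<noteq> 0" for i
    using q by (rule qpoch_nonzero)
  have nz1: "1 - q * q ^ i \<noteq> 0" for i
    using power_neq_1[OF q, of "Suc i"] by simp
  define A B C where "A = qpoch q q n" and "B = qpoch q q k" and "C = qpoch q q d"
  define X Y where "X = q ^ k" and "Y = q ^ d"
  have nz': "A \<noteq> 0" "B \<noteq> 0" "C \<noteq> 0" "1 - q * X \<noteq> 0" "1 - q * Y \<noteq> 0"
    using nz nz1 by (auto simp: A_def B_def C_def X_def Y_def)
  have e: "qpoch q q (Suc n) = A * (1 - q * q * X * Y)" "qpoch q q (Suc k) = B * (1 - q * X)"
     "qpoch q q (Suc d) = C * (1 - q * Y)" "q ^ n = q * X * Y"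
    by (auto simp: qpoch_Suc A_def B_def C_def X_def Y_def n power_add)
  have "qbin q (Suc n) (Suc k) = A * (1 - q * q * X * Y) / (B * (1 - q * X) * (C * (1 - q * Y)))"
    using e n by (simp add: qbin_def Suc_diff_le)
  moreover have "qbin q n (Suc k) = A / (B * (1 - q * X) * C)"
    using e n by (simp add: qbin_def A_def C_def)
  moreover have "qbin q n k = A / (B * (C * (1 - q * Y)))"
    using e n by (simp add: qbin_def A_def B_def Suc_diff_le)
  moreover have "q ^ (n - k) = q * Y"
    using n by (simp add: Y_def Suc_diff_le)
  moreover have "A * (1 - q * q * X * Y) / (B * (1 - q * X) * (C * (1 - q * Y)))
     = A / (B * (1 - q * X) * C) + q * Y * (A / (B * (C * (1 - q * Y))))"
    using nz' by (simp add: divide_simps) (simp add: algebra_simps)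
  ultimately show ?thesis by simp
qed

lemma qbin_0 [simp]: "norm q < 1 \<Longrightarrow> qbin q n 0 = 1" 
  and qbin_self [simp]: "norm q < 1 \<Longrightarrow> qbin q n n = 1"
  using qpoch_nonzero by (auto simp: qbin_def)

text \<open>Multiplication by a factor \<open>1 + c\<close> at the level of coefficients. The two
  end terms are kept apart because Pascal's rule for \<open>qbin\<close> does not reach
  them.\<close>

lemma sum_pascal_step:
  fixes f g :: "nat \<Rightarrow> 'a::comm_ring_1"
  assumes "g 0 = f 0" "\<And>i. i < n \<Longrightarrow> g (Suc i) = f (Suc i) + c * f i" "g (Suc n) = c * f n"
  shows "(\<Sum>i\<le>Suc n. g i) = (\<Sum>i\<le>n. f i) + c * (\<Sum>i\<le>n. f i)"
proof -
  have "(\<Sum>i\<le>Suc n. g i) = g 0 + (\<Sum>i<n. g (Suc i)) + g (Suc n)"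
    unfolding lessThan_Suc_atMost [symmetric] sum.lessThan_Suc[of g "Suc n"] sum.lessThan_Suc_shift[of g n] ..
  also have "(\<Sum>i<n. g (Suc i)) = (\<Sum>i<n. f (Suc i)) + c * (\<Sum>i<n. f i)"
    using assms(2) by (simp add: sum.distrib sum_distrib_left)
  also have "g 0 + ((\<Sum>i<n. f (Suc i)) + c * (\<Sum>i<n. f i)) + g (Suc n) =
      (f 0 + (\<Sum>i<n. f (Suc i))) + c * ((\<Sum>i<n. f i) + f n)"
    using assms(1,3) by (simp add: algebra_simps)
  also have "f 0 + (\<Sum>i<n. f (Suc i)) = (\<Sum>i\<le>n. f i)"
    unfolding lessThan_Suc_atMost [symmetric] by (rule sum.lessThan_Suc_shift [symmetric])
  also have "(\<Sum>i<n. f i) + f n = (\<Sum>i\<le>n. f i)"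
    unfolding lessThan_Suc_atMost [symmetric] by simp
  finally show ?thesis .
qed

text \<open>Induction on the number of factors, the new one being absorbed by the q-Pascal rule. The
  base \<open>s\<^sup>2\<close> makes the usual q^(i (i - 1) / 2) an integral power of
  \<open>s\<close>.\<close>

lemma qbinomial_theorem:
  fixes s x :: complex
  assumes s: "norm s < 1"
  shows "(\<Prod>k<n. 1 + x * (s\<^sup>2) ^ k) = (\<Sum>i\<le>n. qbin (s\<^sup>2) n i * s ^ (i * (i - 1)) * x ^ i)"
proof (induction n)
  case 0
  then show ?case by (simp add: qbin_def)
next
  case (Suc n)
  have q: "norm (s\<^sup>2) < 1" using s by (intro norm_power_lt_1) auto
  let ?f = "\<lambda>n i. qbin (s\<^sup>2) n i * s ^ (i * (i - 1)) * x ^ i"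
  have step: "?f (Suc n) (Suc i) = ?f n (Suc i) + x * (s\<^sup>2) ^ n * ?f n i" if "i < n" for i
  proof -
    have *: "(s\<^sup>2) ^ (n - i) * s ^ (Suc i * i) = (s\<^sup>2) ^ n * s ^ (i * (i - 1))"
    proof -
      have "2 * (n - i) + Suc i * i = 2 * n + i * (i - 1)"
        using that by (cases i) (auto simp: algebra_simps)
      then show ?thesis by (metis power_add power_mult)
    qed
    have "?f (Suc n) (Suc i) = ?f n (Suc i) + qbin (s\<^sup>2) n i * ((s\<^sup>2) ^ (n - i) * s ^ (Suc i * i)) * x ^ Suc i"
      by (simp add: qbin_pascal[OF q that] algebra_simps)
    then show ?thesis
      unfolding * by (simp add: algebra_simps)
  qed
  have top: "?f (Suc n) (Suc n) = x * (s\<^sup>2) ^ n * ?f n n"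
  proof -
    have "Suc n * n = 2 * n + n * (n - 1)" by (cases n) auto
    then have "s ^ (Suc n * n) = (s\<^sup>2) ^ n * s ^ (n * (n - 1))"
      by (metis power_add power_mult)
    then show ?thesis using q by (simp add: algebra_simps)
  qed
  have "(\<Prod>k<Suc n. 1 + x * (s\<^sup>2) ^ k) = (\<Sum>i\<le>n. ?f n i) + x * (s\<^sup>2) ^ n * (\<Sum>i\<le>n. ?f n i)"
    by (simp add: Suc algebra_simps)
  also have "\<dots> = (\<Sum>i\<le>Suc n. ?f (Suc n) i)"
    by (rule sum_pascal_step [symmetric]) (use q step top in auto)
  finally show ?case .
qed

section \<open>The Jacobi triple product\<close>

text \<open>The nome is \<open>s\<close> with \<open>q = s\<^sup>2\<close>, which keeps the exponent of \<open>q^(j (j - 1) / 2)\<close> free of division.\<close>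

definition theta_term :: "complex \<Rightarrow> complex \<Rightarrow> int \<Rightarrow> complex" where
  "theta_term z s j = (- z) powi j * s powi (j * (j - 1))"

text \<open>Ratio test: the quotient of consecutive terms is \<open>R * (r\<^sup>2) ^ n\<close>,
  which tends to 0.\<close>

lemma summable_theta_nat:
  fixes r R :: real
  assumes "0 < r" "r < 1" "0 < R"
  shows "summable (\<lambda>n. R ^ n * r ^ (n * (n - 1)))"
proof -
  have "(\<lambda>n. R * (r\<^sup>2) ^ n) \<longlonglongrightarrow> R * 0"
    using assms by (intro tendsto_mult tendsto_const LIMSEQ_realpow_zero) (auto simp: power_less_one_iff)
  then have "eventually (\<lambda>n. R * (r\<^sup>2) ^ n < 1 / 2) sequentially"
    by (rule order_tendstoD) simp
  then obtain N where N: "R * (r\<^sup>2) ^ n < 1 / 2" if "n \<ge> N" for n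
    by (auto simp: eventually_sequentially)
  show ?thesis
  proof (rule summable_ratio_test[of "1 / 2" N])
    fix n assume "n \<ge> N"
    have "Suc n * n = 2 * n + n * (n - 1)" by (cases n) auto
    then have "r ^ (Suc n * n) = (r\<^sup>2) ^ n * r ^ (n * (n - 1))"
      by (metis power_add power_mult)
    then have "R ^ Suc n * r ^ (Suc n * n) = (R * (r\<^sup>2) ^ n) * (R ^ n * r ^ (n * (n - 1)))"
      by simp
    also have "\<dots> \<le> 1 / 2 * (R ^ n * r ^ (n * (n - 1)))"
      using assms N[OF \<open>n \<ge> N\<close>] by (intro mult_right_mono) auto
    finally show "norm (R ^ Suc n * r ^ (Suc n * (Suc n - 1))) \<le> 1 / 2 * norm (R ^ n * r ^ (n * (n - 1)))"
      using assms by simp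
  qed simp
qed

lemma theta_term_summable:
  assumes "z \<noteq> 0" "s \<noteq> 0" "norm s < 1"
  shows "(\<lambda>j. norm (theta_term z s j)) summable_on UNIV"
proof -
  define r where "r = norm s"
  have r: "0 < r" "r < 1" using assms by (auto simp: r_def)
  have nat_case: "(\<lambda>n. R ^ n * r ^ (n * (n - 1))) summable_on UNIV" if "R > 0" for R :: real
    using summable_theta_nat[OF r that] r that
    by (subst summable_on_UNIV_nonneg_real_iff) auto
  have "(\<lambda>j. norm (theta_term z s j)) summable_on range int"
  proof -
    have "((\<lambda>j. norm (theta_term z s j)) \<circ> int) n = norm z ^ n * r ^ (n * (n - 1))" for n
    proof -
      have "int n * (int n - 1) = int (n * (n - 1))" by (cases n) (auto simp: algebra_simps)
      then show ?thesis
        by (simp add: theta_term_def norm_mult norm_power r_def norm_power_int del: of_nat_mult)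
    qed
    then show ?thesis
      using nat_case[of "norm z"] assms
      by (subst summable_on_reindex) (auto simp: o_def inj_on_def cong: summable_on_cong)
  qed
  moreover have "(\<lambda>j. norm (theta_term z s j)) summable_on range (\<lambda>n. - int n)"
  proof -
    \<comment> \<open>Since (-n)(-n - 1) = n (n - 1) + 2 n, the negative half has the same shape
      with \<open>R = r\<^sup>2 / norm z\<close>.\<close>
    have "((\<lambda>j. norm (theta_term z s j)) \<circ> (\<lambda>n. - int n)) n = (r\<^sup>2 / norm z) ^ n * r ^ (n * (n - 1))" for n
    proof -
      have *: "(- int n) * (- int n - 1) = int (n * (n + 1))" by (simp add: algebra_simps)
      have "n * (n + 1) = 2 * n + n * (n - 1)" by (cases n) auto
      then have "r ^ (n * (n + 1)) = (r\<^sup>2) ^ n * r ^ (n * (n - 1))"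
        by (metis power_add power_mult)
      then show ?thesis
        unfolding o_def theta_term_def *
        by (simp add: norm_mult norm_divide norm_power r_def norm_power_int power_int_minus power_divide field_simps
                 del: of_nat_mult of_nat_add of_nat_Suc)
    qed
    then show ?thesis
      using nat_case[of "r\<^sup>2 / norm z"] assms r
      by (subst summable_on_reindex) (auto simp: o_def inj_on_def cong: summable_on_cong)
  qed
  ultimately have "(\<lambda>j. norm (theta_term z s j)) summable_on (range int \<union> range (\<lambda>n. - int n))"
    by (rule summable_on_union)
  moreover have "range int \<union> range (\<lambda>n. - int n) = UNIV"
  proof -
    have "j \<in> range int \<union> range (\<lambda>n. - int n)" for j
      by (cases j rule: int_cases2) auto
    then show ?thesis by blast
  qed
  ultimately show ?thesis by simp
qed

text \<open>Tannery's theorem for bilateral series: \<open>int_decode\<close> enumerates the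
  integers, so the version over the naturals applies.\<close>

lemma has_sum_int_dominated_limit:
  fixes f :: "nat \<Rightarrow> int \<Rightarrow> complex"
  assumes lim: "\<And>j. (\<lambda>n. f n j) \<longlonglongrightarrow> g j"
    and bound: "\<And>n j. norm (f n j) \<le> M j"
    and M: "M summable_on UNIV"
    and fin: "\<And>n. finite (A n)" "\<And>n j. j \<notin> A n \<Longrightarrow> f n j = 0"
    and S: "(\<lambda>n. \<Sum>j\<in>A n. f n j) \<longlonglongrightarrow> S"
  shows "(g has_sum S) UNIV"
proof -
  have M0: "M j \<ge> 0" for j using bound[of 0 j] norm_ge_zero order_trans by blast
  have "(\<lambda>k. M (int_decode k)) summable_on UNIV"
    using M by (subst summable_on_reindex_bij_betw[OF bij_int_decode])
  then have sM: "summable (\<lambda>k. M (int_decode k))"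
    using M0 by (simp add: summable_on_UNIV_nonneg_real_iff)
  have B: "\<forall>\<^sub>F (k, n) in sequentially \<times>\<^sub>F sequentially. norm (f n (int_decode k)) \<le> M (int_decode k)"
    using bound by (intro always_eventually) auto
  note T = tannerys_theorem[where a="\<lambda>k n. f n (int_decode k)" and b="\<lambda>k. g (int_decode k)"
      and M="\<lambda>k. M (int_decode k)" and F=sequentially, OF lim B sM]
  have T1: "summable (\<lambda>k. norm (g (int_decode k)))"
   and T2: "(\<lambda>n. \<Sum>k. f n (int_decode k)) \<longlonglongrightarrow> (\<Sum>k. g (int_decode k))"
    using T by auto
  have "(\<Sum>k. f n (int_decode k)) = (\<Sum>j\<in>A n. f n j)" for n
  proof -
    have "(f n has_sum (\<Sum>j\<in>A n. f n j)) UNIV"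
      using fin by (intro has_sum_finite_neutralI[of "A n"]) auto
    then have "((\<lambda>k. f n (int_decode k)) has_sum (\<Sum>j\<in>A n. f n j)) UNIV"
      by (subst has_sum_reindex_bij_betw[OF bij_int_decode])
    then show ?thesis
      using sums_unique[OF has_sum_imp_sums] by metis
  qed
  then have "(\<Sum>k. g (int_decode k)) = S"
    using T2 S by (simp add: LIMSEQ_unique)
  then have "(\<lambda>k. g (int_decode k)) sums S"
    using summable_norm_cancel[OF T1] by (simp add: sums_iff)
  then have "((\<lambda>k. g (int_decode k)) has_sum S) UNIV"
    using T1 by (intro norm_summable_imp_has_sum)
  then show ?thesis
    by (subst (asm) has_sum_reindex_bij_betw[OF bij_int_decode])
qed

text \<open>The q-binomial theorem with \<open>2 * n\<close> factors at
  \<open>x = - z / q ^ n\<close>. The upper \<open>n\<close> factors form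
  \<open>qpoch z q n\<close>; in the lower \<open>n\<close>, taken in reverse, pulling out
  \<open>- z / q ^ Suc k\<close> leaves \<open>qpoch (q / z) q n\<close>. The substitution
  \<open>i = j + n\<close> centres the sum.\<close>

lemma finite_jacobi_triple:
  assumes z: "z \<noteq> 0" and s: "s \<noteq> 0" "norm s < 1"
  defines "q \<equiv> s\<^sup>2"
  shows "qpoch z q n * qpoch (q / z) q n =
    (\<Sum>j\<in>{- int n..int n}. theta_term z s j * qbin q (2 * n) (nat (j + int n)))"
proof -
  define x where "x = - z / q ^ n"
  have q: "q \<noteq> 0" using s by (simp add: q_def)
  have pref: "(\<Prod>k<n. - z / q ^ Suc k) = (- z) ^ n / s ^ (n * (n + 1))" for n
  proof (induction n)
    case (Suc n)
    have "Suc n * (Suc n + 1) = n * (n + 1) + 2 * Suc n" by simp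
    then have "s ^ (Suc n * (Suc n + 1)) = s ^ (n * (n + 1)) * q ^ Suc n"
      unfolding q_def by (metis power_add power_mult)
    then show ?case
      unfolding prod.lessThan_Suc Suc.IH by (simp add: field_simps)
  qed simp
  have split: "(\<Prod>k<m+n. g k) = (\<Prod>k<m. g k) * (\<Prod>k<n. g (m + k))" for m n and g :: "nat \<Rightarrow> complex"
    by (induction n) (simp_all add: mult.assoc)
  have "(\<Prod>k<2*n. 1 + x * q ^ k) = (\<Prod>k<n. 1 + x * q ^ k) * (\<Prod>k<n. 1 + x * q ^ (n + k))"
    unfolding mult_2 by (rule split)
  also have "(\<Prod>k<n. 1 + x * q ^ (n + k)) = qpoch z q n"
    using q by (simp add: qpoch_def x_def power_add field_simps)
  also have "(\<Prod>k<n. 1 + x * q ^ k) = (\<Prod>k<n. 1 + x * q ^ (n - Suc k))"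
    by (rule prod.nat_diff_reindex [symmetric])
  also have "\<dots> = (\<Prod>k<n. (- z / q ^ Suc k) * (1 - q / z * q ^ k))"
  proof (rule prod.cong)
    fix k assume "k \<in> {..<n}"
    then have "q ^ n = q ^ (n - Suc k) * q ^ Suc k"
      by (metis lessThan_iff Suc_leI le_add_diff_inverse2 power_add)
    then show "1 + x * q ^ (n - Suc k) = (- z / q ^ Suc k) * (1 - q / z * q ^ k)"
      using q z by (simp add: x_def field_simps)
  qed simp
  also have "\<dots> = (- z) ^ n / s ^ (n * (n + 1)) * qpoch (q / z) q n"
    by (simp only: prod.distrib pref qpoch_def)
  finally have "(- z) ^ n / s ^ (n * (n + 1)) * (qpoch z q n * qpoch (q / z) q n) = (\<Prod>k<2*n. 1 + x * q ^ k)"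
    by (simp add: mult_ac)
  also have "\<dots> = (\<Sum>i\<le>2*n. qbin q (2 * n) i * s ^ (i * (i - 1)) * x ^ i)"
    unfolding q_def by (rule qbinomial_theorem[OF s(2)])
  finally have "qpoch z q n * qpoch (q / z) q n = s ^ (n * (n + 1)) / (- z) ^ n * 
      (\<Sum>i\<le>2*n. qbin q (2 * n) i * s ^ (i * (i - 1)) * x ^ i)"
    using z s by (simp add: field_simps)
  also have "\<dots> = (\<Sum>i\<le>2*n. s ^ (n * (n + 1)) / (- z) ^ n * 
      (qbin q (2 * n) i * s ^ (i * (i - 1)) * x ^ i))"
    by (rule sum_distrib_left)
  also have "\<dots> = (\<Sum>j\<in>{- int n..int n}. theta_term z s j * qbin q (2 * n) (nat (j + int n)))"
  proof (rule sum.reindex_bij_witness[where i="\<lambda>j. nat (j + int n)" and j="\<lambda>i. int i - int n"])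
    fix i assume "i \<in> {..2*n}"
    have "s powi ((int i - int n) * (int i - int n - 1)) = 
       s powi (int (n * (n + 1)) + int (i * (i - 1)) - int (2 * n * i))"
      by (rule arg_cong[of _ _ "\<lambda>k. s powi k"]; cases i) (auto simp: algebra_simps)
    also have "\<dots> = s ^ (n * (n + 1)) * s ^ (i * (i - 1)) / s ^ (2 * n * i)"
      using s(1) by (simp only: power_int_add power_int_diff power_int_of_nat simp_thms)
    finally have 1: "s powi ((int i - int n) * (int i - int n - 1)) = s ^ (n * (n + 1)) * s ^ (i * (i - 1)) / s ^ (2 * n * i)" .
    have 2: "(- z) powi (int i - int n) = (- z) ^ i / (- z) ^ n"
      using z by (simp add: power_int_diff)
    have 3: "x ^ i = (- z) ^ i / s ^ (2 * n * i)"
      unfolding x_def q_def power_mult power_divide ..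
    show "theta_term z s (int i - int n) * qbin q (2 * n) (nat (int i - int n + int n)) =
       s ^ (n * (n + 1)) / (- z) ^ n * (qbin q (2 * n) i * s ^ (i * (i - 1)) * x ^ i)"
      unfolding theta_term_def 1 2 3 by simp
  qed auto
  finally show ?thesis .
qed

text \<open>Let \<open>n\<close> tend to infinity in \<open>finite_jacobi_triple\<close>: each
  Gaussian binomial tends to \<open>inverse (qprod q q)\<close>, and these coefficients are
  uniformly bounded, so the theta terms dominate.\<close>

theorem jacobi_triple_product:
  assumes z: "z \<noteq> 0" and s: "s \<noteq> 0" "norm s < 1"
  shows "(theta_term z s has_sum qprod z (s\<^sup>2) * qprod (s\<^sup>2 / z) (s\<^sup>2) * qprod (s\<^sup>2) (s\<^sup>2)) UNIV"
proof -
  define q where "q = s\<^sup>2"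
  have q: "norm q < 1" unfolding q_def using s by (intro norm_power_lt_1) auto
  have nz: "qprod q q \<noteq> 0" using qprod_power_nonzero[OF q, of 1 1] by simp
  have conv: "qpoch q q \<longlonglongrightarrow> qprod q q" by (rule qpoch_tendsto[OF q])
  \<comment> \<open>\<open>K\<close> and \<open>L\<close> bound \<open>qpoch q q n\<close> and its
    reciprocal, so \<open>K * (L * L)\<close> bounds every \<open>qbin q m k\<close>.\<close>
  obtain K where K: "norm (qpoch q q n) \<le> K" for n
    using convergent_imp_Bseq[OF convergentI[OF conv]] by (auto simp: Bseq_def)
  obtain L where L: "norm (inverse (qpoch q q n)) \<le> L" for n
    using convergent_imp_Bseq[OF convergentI[OF tendsto_inverse[OF conv nz]]] by (auto simp: Bseq_def)
  have K0: "K \<ge> 0" using K[of 0] norm_ge_zero order_trans by blast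
  have L0: "L \<ge> 0" using L[of 0] norm_ge_zero order_trans by blast
  \<comment> \<open>The cutoff is explicit, since \<open>qbin\<close> does not vanish outside its
    range.\<close>
  define f where "f n j = (if j \<in> {- int n..int n} then theta_term z s j * qbin q (2 * n) (nat (j + int n)) else 0)" for n j
  have S: "(\<lambda>n. \<Sum>j\<in>{- int n..int n}. f n j) \<longlonglongrightarrow> qprod z q * qprod (q / z) q"
  proof -
    have "(\<Sum>j\<in>{- int n..int n}. f n j) = qpoch z q n * qpoch (q / z) q n" for n
      unfolding f_def q_def finite_jacobi_triple[OF assms] by (intro sum.cong) auto
    moreover have "(\<lambda>n. qpoch z q n * qpoch (q / z) q n) \<longlonglongrightarrow> qprod z q * qprod (q / z) q"
      by (intro tendsto_mult qpoch_tendsto q)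
    ultimately show ?thesis by simp
  qed
  have lim: "(\<lambda>n. f n j) \<longlonglongrightarrow> theta_term z s j * inverse (qprod q q)" for j
  proof -
    have l1: "(\<lambda>n. qpoch q q (2 * n)) \<longlonglongrightarrow> qprod q q"
      using LIMSEQ_subseq_LIMSEQ[OF conv, of "\<lambda>n. 2 * n"] by (simp add: strict_mono_def o_def)
    have l2: "(\<lambda>n. qpoch q q (nat (j + int n))) \<longlonglongrightarrow> qprod q q"
      by (rule filterlim_compose[OF conv]) real_asymp
    have l3: "(\<lambda>n. qpoch q q (nat (int n - j))) \<longlonglongrightarrow> qprod q q"
      by (rule filterlim_compose[OF conv]) real_asymp
    have "(\<lambda>n. theta_term z s j * (qpoch q q (2 * n) / (qpoch q q (nat (j + int n)) * qpoch q q (nat (int n - j)))))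
        \<longlonglongrightarrow> theta_term z s j * (qprod q q / (qprod q q * qprod q q))"
      using nz by (intro tendsto_intros l1 l2 l3) auto
    \<comment> \<open>For \<open>n\<close> at least the absolute value of \<open>j\<close> no
      truncation occurs in \<open>nat (j + int n)\<close> or in
      \<open>2 * n - nat (j + int n)\<close>.\<close>
    moreover have "eventually (\<lambda>n. theta_term z s j * (qpoch q q (2 * n) / (qpoch q q (nat (j + int n)) * qpoch q q (nat (int n - j)))) = f n j) sequentially"
      using eventually_ge_at_top[of "nat \<bar>j\<bar>"]
    proof eventually_elim
      case (elim n)
      then have "2 * n - nat (j + int n) = nat (int n - j)" "j \<in> {- int n..int n}" by auto
      then show ?case by (simp add: f_def qbin_def)
    qed
    ultimately have "(\<lambda>n. f n j) \<longlonglongrightarrow> theta_term z s j * (qprod q q / (qprod q q * qprod q q))"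
      by (rule Lim_transform_eventually)
    then show ?thesis using nz by (simp add: field_simps)
  qed
  have bound: "norm (f n j) \<le> norm (theta_term z s j) * (K * (L * L))" for n j
  proof -
    have "norm (qbin q m k) \<le> K * (L * L)" for m k
    proof -
      have "norm (qbin q m k) = norm (qpoch q q m) * (norm (inverse (qpoch q q k)) * norm (inverse (qpoch q q (m - k))))"
        by (simp add: qbin_def norm_mult norm_divide norm_inverse field_simps)
      also have "\<dots> \<le> K * (L * L)"
        using K L K0 L0 by (intro mult_mono) auto
      finally show ?thesis .
    qed
    then show ?thesis using K0 L0
      by (auto simp: f_def norm_mult intro!: mult_left_mono)
  qed
  have "((\<lambda>j. theta_term z s j * inverse (qprod q q)) has_sum qprod z q * qprod (q / z) q) UNIV"
    by (rule has_sum_int_dominated_limit[OF lim bound _ _ _ S])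
       (auto simp: f_def intro!: summable_on_cmult_left theta_term_summable assms)
  then have "((\<lambda>j. theta_term z s j * inverse (qprod q q) * qprod q q) has_sum qprod z q * qprod (q / z) q * qprod q q) UNIV"
    by (rule has_sum_cmult_left)
  then show ?thesis using nz by (simp add: q_def mult.assoc)
qed



section \<open>The quintuple product\<close>

lemma theta_term_alt: "theta_term z s j = (if even j then 1 else - 1) * z powi j * s powi (j * (j - 1))"
  unfolding theta_term_def power_int_minus_left by simp

lemma has_sum_mult_Times:
  fixes f :: "'a \<Rightarrow> 'c::{real_normed_field,banach}" and g :: "'b \<Rightarrow> 'c"
  assumes f: "(\<lambda>x. norm (f x)) summable_on A" "(f has_sum a) A"
    and g: "(\<lambda>x. norm (g x)) summable_on B" "(g has_sum b) B"
  shows "((\<lambda>(x, y). f x * g y) has_sum a * b) (A \<times> B)"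
proof (rule has_sum_SigmaI)
  show "((\<lambda>y. case (x, y) of (x, y) \<Rightarrow> f x * g y) has_sum f x * b) B" for x
    using has_sum_cmult_right[OF g(2), of "f x"] by simp
  show "((\<lambda>x. f x * b) has_sum a * b) A"
    by (rule has_sum_cmult_left[OF f(2)])
  have "(\<lambda>p. norm (case p of (x, y) \<Rightarrow> f x * g y)) summable_on A \<times> B"
  proof (rule summable_on_SigmaI)
    show "((\<lambda>y. norm (case (x, y) of (x, y) \<Rightarrow> f x * g y)) has_sum norm (f x) * infsum (\<lambda>y. norm (g y)) B) B" for x
      using has_sum_cmult_right[OF has_sum_infsum[OF g(1)], of "norm (f x)"] by (simp add: norm_mult)
    show "(\<lambda>x. norm (f x) * infsum (\<lambda>y. norm (g y)) B) summable_on A"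
      by (intro summable_on_cmult_left f)
  qed simp
  then show "(\<lambda>(x, y). f x * g y) summable_on A \<times> B"
    by (rule abs_summable_summable)
qed

text \<open>Division with remainder maps the integers bijectively to pairs of remainder and
  quotient. Used below for \<open>m\<close> = 3, 2 and 6.\<close>

lemma has_sum_int_residue_classes:
  fixes f :: "int \<Rightarrow> complex" and m :: nat
  assumes f: "(f has_sum S) UNIV" and "m > 0"
    and g: "\<And>r. r < m \<Longrightarrow> ((\<lambda>k. f (int m * k + int r)) has_sum g r) UNIV"
  shows "S = (\<Sum>r<m. g r)"
proof -
  have "((\<lambda>(r, k). f (int m * k + int r)) has_sum S) ({..<m} \<times> UNIV)"
  proof -
    have "(f has_sum S) UNIV = ((\<lambda>(r, k). f (int m * k + int r)) has_sum S) ({..<m} \<times> UNIV)"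
      by (rule has_sum_reindex_bij_witness[where j="\<lambda>i. (nat (i mod int m), i div int m)" and i="\<lambda>(r, k). int m * k + int r"])
         (use \<open>m > 0\<close> in \<open>auto simp: nat_less_iff div_mult_self4 zmod_int\<close>)
    then show ?thesis using f by simp
  qed
  then have "(g has_sum S) {..<m}"
    by (rule has_sum_SigmaD) (use g in auto)
  then show ?thesis by (simp add: has_sum_finite_iff)
qed

lemma qprod_1_left: "norm q < 1 \<Longrightarrow> qprod 1 q = 0"
proof -
  assume "norm q < 1"
  moreover have "(\<lambda>n. qpoch 1 q (Suc n)) = (\<lambda>n. 0)"
    unfolding qpoch_def prod.lessThan_Suc_shift by simp
  ultimately show ?thesis
    by (metis LIMSEQ_Suc LIMSEQ_const_iff qpoch_tendsto)
qed

lemma qprod_q_q_3: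
  assumes "norm q < 1"
  shows "qprod q (q ^ 3) * qprod (q ^ 2) (q ^ 3) * qprod (q ^ 3) (q ^ 3) = qprod q q"
  using qprod_dissect[OF assms, of 3 q] by (simp add: eval_nat_numeral mult_ac)

lemma quintuple_product:
  assumes z: "z \<noteq> 0" and t: "t \<noteq> 0" "norm t < 1"
  defines "p \<equiv> t\<^sup>2"
  shows "((\<lambda>l. z powi (3 * l) * t powi (l * (3 * l - 1)) - z powi (3 * l + 1) * t powi (l * (3 * l + 1)))
     has_sum qprod p p * qprod z p * qprod (p / z) p * qprod (p * z\<^sup>2) (p\<^sup>2) * qprod (p / z\<^sup>2) (p\<^sup>2)) UNIV"
proof -
  have p: "p \<noteq> 0" "norm p < 1" using t unfolding p_def by (auto intro: norm_power_lt_1)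
  define J1 where "J1 = qprod z p * qprod (p / z) p * qprod p p"
  define J2 where "J2 = qprod (p * z\<^sup>2) (p\<^sup>2) * qprod (p / z\<^sup>2) (p\<^sup>2) * qprod (p\<^sup>2) (p\<^sup>2)"
  define G where "G = qprod (p\<^sup>2) (p\<^sup>2)"
  \<comment> \<open>In the product of the triple products for \<open>z\<close> and \<open>p z\<^sup>2\<close>, collect the coefficient of \<open>z^k\<close>; up to a
    monomial it depends only on \<open>k mod 3\<close>, and it vanishes for \<open>k mod 3 = 2\<close>.\<close>
  define H where "H k n = theta_term z t (k - 2 * n) * theta_term (p * z\<^sup>2) p n" for k n
  have H: "H k n = (if even (k + n) then 1 else - 1) * z powi k * t powi ((k - 2 * n) * (k - 2 * n - 1) + 2 * n\<^sup>2)" for k n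
  proof -
    have "(p * z\<^sup>2) powi n = t powi (2 * n) * z powi (2 * n)"
      unfolding p_def by (simp add: power_int_mult_distrib power_int_mult)
    moreover have "p powi (n * (n - 1)) = t powi (2 * n * (n - 1))"
      unfolding p_def by (simp add: power_int_mult mult.assoc)
    moreover have "z powi k = z powi (k - 2 * n) * z powi (2 * n)"
      using z by (simp flip: power_int_add)
    moreover have "t powi ((k - 2 * n) * (k - 2 * n - 1) + 2 * n\<^sup>2) = 
       t powi ((k - 2 * n) * (k - 2 * n - 1)) * (t powi (2 * n) * t powi (2 * n * (n - 1)))"
    proof -
      have "(k - 2 * n) * (k - 2 * n - 1) + 2 * n\<^sup>2 = (k - 2 * n) * (k - 2 * n - 1) + (2 * n + 2 * n * (n - 1))"
        by (simp add: algebra_simps power2_eq_square)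
      then show ?thesis
        using t by (simp add: power_int_add)
    qed
    ultimately show ?thesis
      unfolding H_def theta_term_alt by (auto simp: mult_ac)
  qed
  have Th: "theta_term (p ^ 4) (p ^ 3) n = (if even n then 1 else - 1) * t powi (6 * n\<^sup>2 + 2 * n)" for n
  proof -
    have "p ^ 4 = t ^ 8" "p ^ 3 = t ^ 6" by (simp_all add: p_def flip: power_mult)
    moreover have "6 * n\<^sup>2 + 2 * n = 8 * n + 6 * (n * (n - 1))"
      by (simp add: algebra_simps power2_eq_square)
    ultimately show ?thesis
      using t unfolding theta_term_alt by (simp add: power_int_add power_int_power)
  qed
  have Th1: "theta_term 1 (t ^ 6) n = (if even n then 1 else - 1) * t powi (6 * (n * (n - 1)))" for n
    unfolding theta_term_alt by (simp add: power_int_power)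
  have "((\<lambda>(m, n). theta_term z t m * theta_term (p * z\<^sup>2) p n) has_sum J1 * J2) (UNIV \<times> UNIV)"
  proof (rule has_sum_mult_Times)
    show "(theta_term z t has_sum J1) UNIV"
      using jacobi_triple_product[OF z t] by (simp add: J1_def p_def)
    show "(theta_term (p * z\<^sup>2) p has_sum J2) UNIV"
      using jacobi_triple_product[of "p * z\<^sup>2" p] z p by (simp add: J2_def power2_eq_square)
  qed (use z t p in \<open>auto intro!: theta_term_summable\<close>)
  also have "?this \<longleftrightarrow> ((\<lambda>(k, n). H k n) has_sum J1 * J2) (UNIV \<times> UNIV)"
    by (rule has_sum_reindex_bij_witness[where i="\<lambda>(k, n). (k - 2 * n, n)" and j="\<lambda>(m, n). (m + 2 * n, n)"])
       (auto simp: H_def)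
  finally have sumH: "((\<lambda>(k, n). H k n) has_sum J1 * J2) (UNIV \<times> UNIV)" .
  \<comment> \<open>The triple product at p^4 with base p^6 has the factors (p^4;p^6), (p^2;p^6),
    (p^6;p^6), which together form (p^2;p^2), the last factor of \<open>J2\<close>.\<close>
  have G: "(theta_term (p ^ 4) (p ^ 3) has_sum G) UNIV"
  proof -
    have "(p ^ 3)\<^sup>2 = (p\<^sup>2) ^ 3" "p ^ 4 = (p\<^sup>2) ^ 2" by (simp_all flip: power_mult)
    moreover have "(p\<^sup>2) ^ 3 / (p\<^sup>2) ^ 2 = p\<^sup>2" using p by (simp add: field_simps eval_nat_numeral)
    ultimately show ?thesis
      using jacobi_triple_product[of "p ^ 4" "p ^ 3"] p qprod_q_q_3[of "p\<^sup>2"] 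
      by (simp add: G_def norm_power_lt_1 mult_ac)
  qed
  \<comment> \<open>At z = 1 the product contains the factor 1 - 1; this kills the class of 2 modulo
    3.\<close>
  have G1: "(theta_term 1 (t ^ 6) has_sum 0) UNIV"
    using jacobi_triple_product[of 1 "t ^ 6"] t
    by (simp add: qprod_1_left norm_power_lt_1 flip: power_mult)
  define g where "g k = infsum (H k) UNIV" for k
  \<comment> \<open>The shift \<open>n + l\<close> completes the square: the exponent splits into
    \<open>l * (3 * l - 1)\<close> and the exponent of the series for \<open>G\<close>. The other
    two classes use \<open>l - n\<close> and \<open>n + l\<close> in the same way.\<close>
  have g0: "(H (3 * l) has_sum z powi (3 * l) * t powi (l * (3 * l - 1)) * G) UNIV" for l
  proof -
    have "H (3 * l) (n + l) = z powi (3 * l) * t powi (l * (3 * l - 1)) * theta_term (p ^ 4) (p ^ 3) n" for n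
    proof -
      have "(3 * l - 2 * (n + l)) * (3 * l - 2 * (n + l) - 1) + 2 * (n + l)\<^sup>2 = l * (3 * l - 1) + (6 * n\<^sup>2 + 2 * n)"
        by (simp add: algebra_simps power2_eq_square)
      then show ?thesis using t unfolding H Th by (simp add: power_int_add)
    qed
    then have "((\<lambda>n. H (3 * l) (n + l)) has_sum z powi (3 * l) * t powi (l * (3 * l - 1)) * G) UNIV"
      using has_sum_cmult_right[OF G] by simp
    also have "?this \<longleftrightarrow> ?thesis"
      by (rule has_sum_reindex_bij_witness[where i="\<lambda>n. n - l" and j="\<lambda>n. n + l"]) auto
    finally show ?thesis .
  qed
  have g1: "(H (3 * l + 1) has_sum - (z powi (3 * l + 1) * t powi (l * (3 * l + 1))) * G) UNIV" for l
  proof -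
    have "H (3 * l + 1) (l - n) = - (z powi (3 * l + 1) * t powi (l * (3 * l + 1))) * theta_term (p ^ 4) (p ^ 3) n" for n
    proof -
      have "(3 * l + 1 - 2 * (l - n)) * (3 * l + 1 - 2 * (l - n) - 1) + 2 * (l - n)\<^sup>2 = l * (3 * l + 1) + (6 * n\<^sup>2 + 2 * n)"
        by (simp add: algebra_simps power2_eq_square)
      then show ?thesis using t unfolding H Th by (simp add: power_int_add)
    qed
    then have "((\<lambda>n. H (3 * l + 1) (l - n)) has_sum - (z powi (3 * l + 1) * t powi (l * (3 * l + 1))) * G) UNIV"
      using has_sum_cmult_right[OF G, of "- (z powi (3 * l + 1) * t powi (l * (3 * l + 1)))"] by simp
    also have "?this \<longleftrightarrow> ?thesis"
      by (rule has_sum_reindex_bij_witness[where i="\<lambda>n. l - n" and j="\<lambda>n. l - n"]) auto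
    finally show ?thesis .
  qed
  have g2: "(H (3 * l + 2) has_sum 0) UNIV" for l
  proof -
    have "H (3 * l + 2) (n + l) = z powi (3 * l + 2) * t powi (3 * l\<^sup>2 + 3 * l + 2) * theta_term 1 (t ^ 6) n" for n
    proof -
      have "(3 * l + 2 - 2 * (n + l)) * (3 * l + 2 - 2 * (n + l) - 1) + 2 * (n + l)\<^sup>2 = 3 * l\<^sup>2 + 3 * l + 2 + 6 * (n * (n - 1))"
        by (simp add: algebra_simps power2_eq_square)
      then show ?thesis using t unfolding H Th1 by (simp add: power_int_add)
    qed
    then have "((\<lambda>n. H (3 * l + 2) (n + l)) has_sum 0) UNIV"
      using has_sum_cmult_right[OF G1] by simp
    also have "?this \<longleftrightarrow> ?thesis"
      by (rule has_sum_reindex_bij_witness[where i="\<lambda>n. n - l" and j="\<lambda>n. n + l"]) auto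
    finally show ?thesis .
  qed
  have summable: "H k summable_on UNIV" for k
  proof -
    have "k = 3 * (k div 3) \<or> k = 3 * (k div 3) + 1 \<or> k = 3 * (k div 3) + 2" by presburger
    then show ?thesis using g0 g1 g2 by (metis has_sum_imp_summable)
  qed
  have g: "(g has_sum J1 * J2) UNIV"
    using sumH by (rule has_sum_SigmaD) (use summable in \<open>auto simp: g_def\<close>)
  have gv: "g (3 * l) = z powi (3 * l) * t powi (l * (3 * l - 1)) * G"
      "g (3 * l + 1) = - (z powi (3 * l + 1) * t powi (l * (3 * l + 1))) * G" "g (3 * l + 2) = 0" for l
    using g0 g1 g2 infsumI unfolding g_def by blast+
  have sg: "(\<lambda>k. g (3 * k + r)) summable_on UNIV" for r
  proof -
    have "g summable_on (\<lambda>k. 3 * k + r) ` UNIV"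
      using g has_sum_imp_summable summable_on_subset by blast
    then show ?thesis
      by (subst (asm) summable_on_reindex) (auto simp: inj_on_def o_def)
  qed
  define S where "S r = infsum (\<lambda>k. g (3 * k + int r)) UNIV" for r
  have S: "((\<lambda>k. g (3 * k + int r)) has_sum S r) UNIV" for r
    unfolding S_def using sg by (rule has_sum_infsum)
  have "J1 * J2 = (\<Sum>r<3. S r)"
    using has_sum_int_residue_classes[OF g, of 3 S] S by simp
  moreover have "S 2 = 0"
    using gv by (simp add: S_def)
  ultimately have "J1 * J2 = S 0 + S 1" by (simp add: eval_nat_numeral)
  moreover have "((\<lambda>l. g (3 * l) + g (3 * l + 1)) has_sum S 0 + S 1) UNIV"
    using has_sum_add[OF S[of 0] S[of 1]] by simp
  \<comment> \<open>Dividing by \<open>G\<close> removes both the common factor of the class sums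
    and the last factor of \<open>J2\<close>.\<close>
  ultimately have "((\<lambda>l. (g (3 * l) + g (3 * l + 1)) / G) has_sum J1 * J2 / G) UNIV"
    by (intro has_sum_divide_const) simp
  moreover have "G \<noteq> 0"
    unfolding G_def using qprod_power_nonzero[OF p(2), of 2 2] by simp
  moreover from this have "(g (3 * l) + g (3 * l + 1)) / G =
      z powi (3 * l) * t powi (l * (3 * l - 1)) - z powi (3 * l + 1) * t powi (l * (3 * l + 1))" for l
    unfolding gv by (simp add: diff_divide_distrib)
  moreover from \<open>G \<noteq> 0\<close> have "J1 * J2 / G = qprod p p * qprod z p * qprod (p / z) p * qprod (p * z\<^sup>2) (p\<^sup>2) * qprod (p / z\<^sup>2) (p\<^sup>2)"
    unfolding J1_def J2_def G_def [symmetric] by simp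
  ultimately show ?thesis by simp
qed

section \<open>The theta function identity\<close>

lemma qprod_q_q_2:
  assumes "norm q < 1"
  shows "qprod q q = qprod q (q\<^sup>2) * qprod (q\<^sup>2) (q\<^sup>2)"
  using qprod_dissect[OF assms, of 2 q] by (simp add: eval_nat_numeral)

lemma qprod_head:
  assumes "norm q < 1"
  shows "qprod a q = (1 - a) * qprod (a * q) q"
proof -
  have "(\<lambda>n. qpoch a q (Suc n)) = (\<lambda>n. (1 - a) * qpoch (a * q) q n)"
    unfolding qpoch_def prod.lessThan_Suc_shift by (simp add: mult_ac)
  moreover have "(\<lambda>n. qpoch a q (Suc n)) \<longlonglongrightarrow> qprod a q"
    by (intro LIMSEQ_Suc qpoch_tendsto assms)
  moreover have "(\<lambda>n. (1 - a) * qpoch (a * q) q n) \<longlonglongrightarrow> (1 - a) * qprod (a * q) q"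
    by (intro tendsto_intros qpoch_tendsto assms)
  ultimately show ?thesis by (simp add: LIMSEQ_unique)
qed

text \<open>Euler's theorem on odd and distinct parts: both (q;q)(-q;q) and (q;q)/(q;q^2) equal
  (q^2;q^2).\<close>

lemma euler_odd_distinct:
  assumes "norm q < 1"
  shows "qprod (- q) q * qprod q (q\<^sup>2) = 1"
proof -
  have "qprod (q\<^sup>2) (q\<^sup>2) \<noteq> 0"
    using qprod_power_nonzero[OF assms, of 2 2] by simp
  moreover have "qprod q (q\<^sup>2) * qprod (q\<^sup>2) (q\<^sup>2) * qprod (- q) q = qprod (q\<^sup>2) (q\<^sup>2)"
    using qprod_diff_squares[OF assms, of q] qprod_q_q_2[OF assms] by simp
  ultimately show ?thesis by (simp add: mult_ac)
qed

text \<open>Gauss's product for \<phi>(-q): the triple product at \<open>q\<close> with nome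
  \<open>q\<close>, where (q;q^2)^2 (q^2;q^2) = (q;q)(q;q^2).\<close>

lemma theta_square:
  assumes "q \<noteq> 0" "norm q < 1"
  shows "((\<lambda>j. (if even j then 1 else - 1) * q powi (j\<^sup>2)) has_sum qprod q q * qprod q (q\<^sup>2)) UNIV"
proof -
  have "theta_term q q = (\<lambda>j. (if even j then 1 else - 1) * q powi (j\<^sup>2))"
  proof
    fix j
    have "q powi j * q powi (j * (j - 1)) = q powi (j\<^sup>2)"
      using assms(1) by (simp add: algebra_simps power2_eq_square flip: power_int_add)
    then show "theta_term q q j = (if even j then 1 else - 1) * q powi (j\<^sup>2)"
      by (simp add: theta_term_alt mult.assoc)
  qed
  then show ?thesis
    using jacobi_triple_product[of q q] assms qprod_q_q_2[OF assms(2)]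
    by (simp add: power2_eq_square mult_ac)
qed

text \<open>Multiplies (1 + x)(1 + w x)(1 + w^2 x) = 1 + x^3 over x = q^(k+1); Euler's identity for
  \<open>q\<close> and \<open>q ^ 3\<close> then replaces (-q;q) and (-q^3;q^3) by reciprocals. This
  links the triple product at \<open>- w\<close> to \<phi>(-q) / (q^3;q^6).\<close>

lemma qprod_cube_roots:
  assumes q: "norm q < 1" and w: "1 + w + w\<^sup>2 = 0"
  shows "qprod (- w * q) q * qprod (- (w\<^sup>2) * q) q * qprod (q ^ 3) (q ^ 6) = qprod q (q\<^sup>2)"
proof -
  define X where "X = qprod (- w * q) q * qprod (- (w\<^sup>2) * q) q"
  have w2: "w\<^sup>2 = - 1 - w" using w by (simp add: algebra_simps eq_neg_iff_add_eq_0)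
  have w3: "w * w\<^sup>2 = 1"
  proof -
    have "w * w\<^sup>2 - 1 = (w - 1) * (1 + w + w\<^sup>2)" by (simp add: algebra_simps power2_eq_square)
    then show ?thesis using w by simp
  qed
  have fac: "(1 + w * x) * (1 + w\<^sup>2 * x) * (1 + x) = 1 + x ^ 3" for x
  proof -
    have "(1 + w * x) * (1 + w\<^sup>2 * x) = 1 + (w + w\<^sup>2) * x + (w * w\<^sup>2) * x\<^sup>2"
      by (simp add: algebra_simps power2_eq_square)
    also have "\<dots> = 1 - x + x\<^sup>2"
      unfolding w3 using w2 by simp
    finally show ?thesis
      by (simp only:) (simp add: algebra_simps power2_eq_square power3_eq_cube)
  qed
  have "qpoch (- w * q) q n * qpoch (- (w\<^sup>2) * q) q n * qpoch (- q) q n = qpoch (- (q ^ 3)) (q ^ 3) n" for n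
  proof -
    have "(1 - (- w * q) * q ^ k) * (1 - (- (w\<^sup>2) * q) * q ^ k) * (1 - (- q) * q ^ k) = 1 - (- (q ^ 3)) * (q ^ 3) ^ k" for k
    proof -
      have "(q * q ^ k) ^ 3 = q ^ 3 * (q ^ 3) ^ k"
        by (simp add: power_mult_distrib mult.commute flip: power_mult)
      then show ?thesis using fac[of "q * q ^ k"] by (simp add: mult.assoc)
    qed
    then show ?thesis unfolding qpoch_def prod.distrib [symmetric] by simp
  qed
  moreover have "(\<lambda>n. qpoch (- w * q) q n * qpoch (- (w\<^sup>2) * q) q n * qpoch (- q) q n) \<longlonglongrightarrow> X * qprod (- q) q"
    unfolding X_def by (intro tendsto_intros qpoch_tendsto q)
  moreover have q3: "norm (q ^ 3) < 1" using q by (intro norm_power_lt_1) auto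
  moreover have "qpoch (- (q ^ 3)) (q ^ 3) \<longlonglongrightarrow> qprod (- (q ^ 3)) (q ^ 3)"
    by (intro qpoch_tendsto q3)
  ultimately have "X * qprod (- q) q = qprod (- (q ^ 3)) (q ^ 3)"
    by (simp add: LIMSEQ_unique)
  \<comment> \<open>Both sides are 1 by Euler's identity.\<close>
  moreover have "qprod (- (q ^ 3)) (q ^ 3) * qprod (q ^ 3) (q ^ 6) = qprod (- q) q * qprod q (q\<^sup>2)"
    using euler_odd_distinct[OF q] euler_odd_distinct[OF q3] by (simp flip: power_mult)
  ultimately have "X * qprod (q ^ 3) (q ^ 6) * qprod (- q) q = qprod (- q) q * qprod q (q\<^sup>2)"
    by (metis (no_types, lifting) mult.assoc mult.commute)
  moreover have "qprod (- q) q \<noteq> 0" using euler_odd_distinct[OF q] by auto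
  ultimately show ?thesis by (simp add: X_def mult.assoc)
qed

text \<open>The left side is \<phi>(-q^3) - \<phi>(-q). Divided by (q^3;q^6), the two terms become
  \<open>u 0 - u 3\<close> and \<open>u 0 + u 3 - 2 * u 2\<close>; their difference
  \<open>2 * (u 2 - u 3)\<close> is evaluated by the quintuple product.\<close>

lemma theta_difference:
  assumes s: "s \<noteq> 0" "norm s < 1" and q_def: "q = s\<^sup>2"
  shows "qprod (q ^ 3) (q ^ 3) * qprod (q ^ 3) (q ^ 6) - qprod q q * qprod q (q\<^sup>2) =
    2 * q * qprod (q ^ 3) (q ^ 6) * (qprod (q ^ 12) (q ^ 12) * qprod (q ^ 5) (q ^ 12) * qprod (q ^ 7) (q ^ 12) *
      qprod (q ^ 22) (q ^ 24) * qprod (q ^ 2) (q ^ 24))" (is "_ = _ * ?Q")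
proof -
  have q: "q \<noteq> 0" "norm q < 1" using s unfolding q_def by (auto intro: norm_power_lt_1)
  \<comment> \<open>All three series are combinations of the six sections \<open>u r\<close>, and \<open>n \<mapsto> 1 - n\<close> identifies these in pairs.\<close>
  define f where "f n = s powi (n * (n - 1))" for n
  define u where "u r = infsum (\<lambda>k. f (6 * k + r)) UNIV" for r
  have "f summable_on UNIV"
  proof -
    have "theta_term (- 1) s = f" by (simp add: theta_term_def f_def fun_eq_iff)
    then show ?thesis
      using theta_term_summable[of "- 1" s] s abs_summable_summable by auto
  qed
  then have "f summable_on (\<lambda>k. 6 * k + r) ` UNIV" for r
    using summable_on_subset by blast
  then have u: "((\<lambda>k. f (6 * k + r)) has_sum u r) UNIV" for r
    unfolding u_def by (subst (asm) summable_on_reindex) (auto simp: inj_on_def o_def)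
  have refl: "((\<lambda>k. f (6 * k + r)) has_sum S) UNIV" if "((\<lambda>k. f (6 * k + r')) has_sum S) UNIV" "r + r' = 6 * c + 1" for r r' c S
  proof -
    have "f (6 * (- k - c) + r') = f (6 * k + r)" for k
    proof -
      have r': "r' = 6 * c + 1 - r" using that by simp
      show ?thesis unfolding f_def r' by (rule arg_cong[of _ _ "\<lambda>k. s powi k"]) (simp add: algebra_simps)
    qed
    then have "((\<lambda>k. f (6 * k + r)) has_sum S) UNIV = ((\<lambda>k. f (6 * k + r')) has_sum S) UNIV"
      by (intro has_sum_reindex_bij_witness[where i="\<lambda>k. - k - c" and j="\<lambda>k. - k - c"]) auto
    then show ?thesis using that by simp
  qed
  have sym: "u 1 = u 0" "u 4 = u 3" "u 5 = u 2"
    using has_sum_unique[OF u[of 1] refl[OF u[of 0], of 1 0]] has_sum_unique[OF u[of 4] refl[OF u[of 3], of 4 1]]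
      has_sum_unique[OF u[of 5] refl[OF u[of 2], of 5 1]] by simp_all
  \<comment> \<open>Triple product at \<open>q ^ 3\<close> with nome \<open>s ^ 9\<close>: the
    exponent 6k + 9k(k - 1) equals 3k(3k - 1), so the terms are \<open>f (3 * k)\<close> with sign
    given by the parity of \<open>k\<close>.\<close>
  have E3: "qprod (q ^ 3) (q ^ 3) = u 0 - u 3"
  proof -
    have "theta_term (q ^ 3) (s ^ 9) = (\<lambda>k. (if even k then 1 else - 1) * f (3 * k))"
    proof
      fix k
      have "s powi (6 * k) * s powi (9 * (k * (k - 1))) = f (3 * k)"
        using s(1) unfolding f_def by (simp add: algebra_simps flip: power_int_add)
      moreover have "(q ^ 3) powi k = s powi (6 * k)"
        by (simp add: q_def power_int_power flip: power_mult)
      ultimately show "theta_term (q ^ 3) (s ^ 9) k = (if even k then 1 else - 1) * f (3 * k)"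
        by (simp add: theta_term_alt power_int_power mult.assoc)
    qed
    moreover have "qprod (q ^ 3) (q ^ 9) * qprod (q ^ 6) (q ^ 9) * qprod (q ^ 9) (q ^ 9) = qprod (q ^ 3) (q ^ 3)"
      using qprod_q_q_3[of "q ^ 3"] q(2) by (simp add: norm_power_lt_1 flip: power_mult)
    moreover have "(s ^ 9)\<^sup>2 = q ^ 9" "q ^ 9 / q ^ 3 = q ^ 6"
      using q(1) by (simp_all add: q_def field_simps flip: power_mult power_add)
    ultimately have "((\<lambda>k. (if even k then 1 else - 1) * f (3 * k)) has_sum qprod (q ^ 3) (q ^ 3)) UNIV"
      using jacobi_triple_product[of "q ^ 3" "s ^ 9"] s q by (simp add: norm_power_lt_1)
    then have "qprod (q ^ 3) (q ^ 3) = (\<Sum>r<2::nat. if r = 0 then u 0 else - u 3)"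
    proof (rule has_sum_int_residue_classes)
      fix r :: nat assume "r < 2"
      then consider "r = 0" | "r = 1" by linarith
      then show "((\<lambda>k. (if even (int 2 * k + int r) then 1 else - 1) * f (3 * (int 2 * k + int r)))
          has_sum (if r = 0 then u 0 else - u 3)) UNIV"
      proof cases
        case 1 then show ?thesis using u[of 0] by simp
      next
        case 2 then show ?thesis using has_sum_uminusI[OF u[of 3]] by (simp add: algebra_simps)
      qed
    qed simp
    then show ?thesis by (simp add: eval_nat_numeral)
  qed
  obtain w :: complex where w: "1 + w + w\<^sup>2 = 0"
  proof
    define w where "w = (- 1 + \<i> * sqrt 3) / 2"
    have "(\<i> * sqrt 3)\<^sup>2 = (- 3 :: complex)"
      by (simp add: power_mult_distrib flip: of_real_power)
    then show "1 + w + w\<^sup>2 = 0"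
      by (simp add: w_def power2_eq_square field_simps)
  qed
  define X where "X = qprod (- w * q) q * qprod (- (w\<^sup>2) * q) q"
  have w3: "w ^ 3 = 1" 
  proof -
    have "w ^ 3 - 1 = (w - 1) * (1 + w + w\<^sup>2)" by (simp add: algebra_simps power2_eq_square power3_eq_cube)
    then show ?thesis using w by simp
  qed
  then have w0: "w \<noteq> 0" by auto
  have w1: "1 + w \<noteq> 0" using w w0 by (metis add_0 power_eq_0_iff)
  \<comment> \<open>Triple product at \<open>- w\<close>: class \<open>r\<close> modulo 6 has weight
    \<open>w ^ r\<close>. Pairing classes by \<open>sym\<close> leaves
    \<open>(1 + w) * (u 0 + u 3) + 2 * w\<^sup>2 * u 2\<close>, and w^2 = -(1 + w) makes
    \<open>1 + w\<close> a common factor.\<close>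
  have E: "qprod q q * X = u 0 + u 3 - 2 * u 2"
  proof -
    have "theta_term (- w) s = (\<lambda>n. w powi n * f n)"
      by (simp add: theta_term_def f_def fun_eq_iff)
    moreover have "q / w = w\<^sup>2 * q"
      using w0 w3 by (simp add: field_simps power2_eq_square power3_eq_cube)
    moreover have "qprod (- w) q = (1 + w) * qprod (- w * q) q"
      using qprod_head[OF q(2), of "- w"] by simp
    ultimately have "((\<lambda>n. w powi n * f n) has_sum (1 + w) * (qprod q q * X)) UNIV"
      using jacobi_triple_product[of "- w" s] s w0 by (simp add: X_def mult_ac flip: q_def)
    then have "(1 + w) * (qprod q q * X) = (\<Sum>r<6::nat. w ^ r * u (int r))"
    proof (rule has_sum_int_residue_classes)
      fix r :: nat
      have "w powi (6 * k + int r) = w ^ r" for k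
      proof -
        have "w ^ 6 = (w ^ 3)\<^sup>2" by simp
        then have "w ^ 6 = 1" unfolding w3 by simp
        then have "w powi (6 * k) = 1" by (simp add: power_int_mult)
        then show ?thesis using w0 by (simp add: power_int_add)
      qed
      then show "((\<lambda>k. w powi (int 6 * k + int r) * f (int 6 * k + int r)) has_sum w ^ r * u (int r)) UNIV"
        using has_sum_cmult_right[OF u[of "int r"], of "w ^ r"] by simp
    qed simp
    also have "\<dots> = u 0 + w * u 1 + w ^ 2 * u 2 + w ^ 3 * u 3 + w * w ^ 3 * u 4 + w ^ 2 * w ^ 3 * u 5"
      by (simp add: eval_nat_numeral)
    also have "\<dots> = (1 + w) * (u 0 + u 3) + 2 * w\<^sup>2 * u 2"
      unfolding w3 sym by (simp add: algebra_simps)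
    also have "w\<^sup>2 = - (1 + w)" using w by (simp only: eq_neg_iff_add_eq_0 add_ac)
    finally have "(1 + w) * (qprod q q * X) = (1 + w) * (u 0 + u 3 - 2 * u 2)"
      by (simp add: algebra_simps)
    then show ?thesis using w1 by simp
  qed
  \<comment> \<open>Quintuple product at \<open>z = q ^ 5\<close> and \<open>t = s ^ 12\<close>,
    chosen so that multiplication by \<open>q\<close> turns its terms into
    \<open>f (6 * l + 2)\<close> and \<open>f (6 * l + 4)\<close>; class 4 is class 3 by
    \<open>sym\<close>.\<close>
  have Q: "q * ?Q = u 2 - u 3"
  proof -
    have e: "(s ^ 12)\<^sup>2 = q ^ 12" "q ^ 12 / q ^ 5 = q ^ 7" "q ^ 12 * (q ^ 5)\<^sup>2 = q ^ 22" "q ^ 12 / (q ^ 5)\<^sup>2 = q\<^sup>2"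
      "(q ^ 12)\<^sup>2 = q ^ 24"
      using q(1) by (simp_all add: q_def field_simps flip: power_mult power_add)
    have "((\<lambda>l. (q ^ 5) powi (3 * l) * (s ^ 12) powi (l * (3 * l - 1)) - (q ^ 5) powi (3 * l + 1) * (s ^ 12) powi (l * (3 * l + 1)))
        has_sum ?Q) UNIV"
    proof -
      have "q ^ 5 \<noteq> 0" "s ^ 12 \<noteq> 0" "norm (s ^ 12) < 1" using s q(1) by (auto intro: norm_power_lt_1)
      from quintuple_product[OF this, unfolded e] show ?thesis by (simp only: mult_ac)
    qed
    then have "((\<lambda>l. q * ((q ^ 5) powi (3 * l) * (s ^ 12) powi (l * (3 * l - 1)) - (q ^ 5) powi (3 * l + 1) * (s ^ 12) powi (l * (3 * l + 1))))
        has_sum q * ?Q) UNIV"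
      by (rule has_sum_cmult_right)
    also have "(\<lambda>l. q * ((q ^ 5) powi (3 * l) * (s ^ 12) powi (l * (3 * l - 1)) - (q ^ 5) powi (3 * l + 1) * (s ^ 12) powi (l * (3 * l + 1))))
       = (\<lambda>l. f (6 * l + 2) - f (6 * l + 4))"
    proof
      fix l
      have "q = s powi 2" "q ^ 5 = s ^ 10" by (simp_all add: q_def flip: power_mult)
      moreover have "s powi 2 * (s powi (10 * (3 * l)) * s powi (12 * (l * (3 * l - 1)))) = f (6 * l + 2)"
      proof -
        have "(6 * l + 2) * (6 * l + 2 - 1) = 2 + (10 * (3 * l) + 12 * (l * (3 * l - 1)))" by (simp add: algebra_simps)
        then show ?thesis
          using s(1) unfolding f_def by (simp only: power_int_add simp_thms)
      qed
      moreover have "s powi 2 * (s powi (10 * (3 * l + 1)) * s powi (12 * (l * (3 * l + 1)))) = f (6 * l + 4)"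
      proof -
        have "(6 * l + 4) * (6 * l + 4 - 1) = 2 + (10 * (3 * l + 1) + 12 * (l * (3 * l + 1)))" by (simp add: algebra_simps)
        then show ?thesis
          using s(1) unfolding f_def by (simp only: power_int_add simp_thms)
      qed
      ultimately show "q * ((q ^ 5) powi (3 * l) * (s ^ 12) powi (l * (3 * l - 1)) - (q ^ 5) powi (3 * l + 1) * (s ^ 12) powi (l * (3 * l + 1)))
         = f (6 * l + 2) - f (6 * l + 4)"
        by (simp add: power_int_power right_diff_distrib)
    qed
    finally have "((\<lambda>l. f (6 * l + 2) - f (6 * l + 4)) has_sum q * ?Q) UNIV" .
    moreover have "((\<lambda>l. f (6 * l + 2) - f (6 * l + 4)) has_sum u 2 - u 4) UNIV"
      using has_sum_add[OF u[of 2] has_sum_uminusI[OF u[of 4]]] by simp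
    ultimately show ?thesis unfolding sym by (rule has_sum_unique)
  qed
  have "qprod q q * qprod q (q\<^sup>2) = qprod q q * X * qprod (q ^ 3) (q ^ 6)"
    using qprod_cube_roots[OF q(2) w] by (simp add: X_def mult_ac)
  then have "qprod (q ^ 3) (q ^ 3) * qprod (q ^ 3) (q ^ 6) - qprod q q * qprod q (q\<^sup>2) = 2 * (q * ?Q) * qprod (q ^ 3) (q ^ 6)"
    unfolding E E3 Q by (simp add: algebra_simps)
  then show ?thesis by (simp add: mult_ac)
qed

section \<open>Generating functions of partitions\<close>

definition num_parts :: "nat set \<Rightarrow> nat \<Rightarrow> nat" where
  "num_parts S n = card {\<pi>. set_mset \<pi> \<subseteq> S \<and> sum_mset \<pi> = n}"

lemma finite_parts:
  fixes S :: "nat set"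
  assumes "0 \<notin> S"
  shows "finite {\<pi>. set_mset \<pi> \<subseteq> S \<and> sum_mset \<pi> = n}"
proof (rule finite_subset)
  show "{\<pi>. set_mset \<pi> \<subseteq> S \<and> sum_mset \<pi> = n} \<subseteq> {\<pi>. partition_of (int n) \<pi>}"
    using assms by (auto simp: partition_of_def simp del: of_nat_sum_mset intro!: Nat.gr0I)
qed (rule finite_partitions)

lemma has_sum_geometric:
  fixes x :: real
  assumes "0 \<le> x" "x < 1"
  shows "((\<lambda>k. x ^ k) has_sum 1 / (1 - x)) UNIV"
  using assms by (intro norm_summable_imp_has_sum geometric_sums) (auto simp: power_abs)

text \<open>Induction on \<open>S\<close>: a multiset over \<open>insert s S\<close> is a
  multiplicity of \<open>s\<close> together with a multiset over \<open>S\<close>, so a geometric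
  series splits off.\<close>

lemma has_sum_multisets_finite:
  fixes x :: real
  assumes x: "0 < x" "x < 1" and "finite S" "0 \<notin> S"
  shows "((\<lambda>\<pi>. x ^ sum_mset \<pi>) has_sum (\<Prod>s\<in>S. 1 / (1 - x ^ s))) {\<pi>. set_mset \<pi> \<subseteq> S}"
  using assms(3,4)
proof (induction S rule: finite_induct)
  case empty
  have "{\<pi> :: nat multiset. set_mset \<pi> \<subseteq> {}} = {{#}}" by auto
  then show ?case by (simp add: has_sum_finite_iff)
next
  case (insert s S)
  have s: "x ^ s < 1" using x insert.prems by (auto simp: power_less_one_iff)
  have IH: "((\<lambda>\<pi>. x ^ sum_mset \<pi>) has_sum (\<Prod>s\<in>S. 1 / (1 - x ^ s))) {\<pi>. set_mset \<pi> \<subseteq> S}"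
    using insert by auto
  have geo: "((\<lambda>k. (x ^ s) ^ k) has_sum 1 / (1 - x ^ s)) UNIV"
    using x s by (intro has_sum_geometric) auto
  have "((\<lambda>(k, \<pi>). (x ^ s) ^ k * x ^ sum_mset \<pi>) has_sum 1 / (1 - x ^ s) * (\<Prod>s\<in>S. 1 / (1 - x ^ s)))
     (UNIV \<times> {\<pi>. set_mset \<pi> \<subseteq> S})"
  proof (rule has_sum_mult_Times)
    show "(\<lambda>k. norm ((x ^ s) ^ k)) summable_on UNIV" "(\<lambda>\<pi>. norm (x ^ sum_mset \<pi>)) summable_on {\<pi>. set_mset \<pi> \<subseteq> S}"
      using has_sum_imp_summable[OF geo] has_sum_imp_summable[OF IH] x by (auto simp: power_abs)
  qed (use geo IH in auto)
  also have "?this \<longleftrightarrow> ((\<lambda>\<pi>. x ^ sum_mset \<pi>) has_sum 1 / (1 - x ^ s) * (\<Prod>s\<in>S. 1 / (1 - x ^ s)))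
     {\<pi>. set_mset \<pi> \<subseteq> insert s S}"
  proof (rule has_sum_reindex_bij_witness[where j="\<lambda>(k, \<pi>). replicate_mset k s + \<pi>" and
           i="\<lambda>\<pi>. (count \<pi> s, filter_mset (\<lambda>y. y \<noteq> s) \<pi>)"], goal_cases)
    case (1 a)
    then show ?case using insert.hyps by (auto intro!: multiset_eqI simp: not_in_iff)
  next
    case (2 a)
    then show ?case by (auto split: if_splits)
  next
    case (3 b)
    then show ?case by (auto intro!: multiset_eqI)
  next
    case (4 b)
    then show ?case by auto
  next
    case (5 a)
    then show ?case by (auto simp: power_add sum_mset_replicate_mset mult.commute simp flip: power_mult)
  qed simp
  finally show ?case using insert.hyps by simp
qed

text \<open>Finitely many multisets use finitely many parts, so their sum is eventually below the
  finite products and thus at most \<open>1 / L\<close>. Conversely, by nonnegativity each finite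
  product is at most the total.\<close>

lemma has_sum_multisets:
  fixes x :: real
  assumes x: "0 < x" "x < 1" and "0 \<notin> S"
    and F: "\<And>N. finite (F N)" "\<And>N. F N \<subseteq> S" "\<And>K. finite K \<Longrightarrow> K \<subseteq> S \<Longrightarrow> eventually (\<lambda>N. K \<subseteq> F N) sequentially"
    and L: "(\<lambda>N::nat. \<Prod>s\<in>F N. 1 - x ^ s) \<longlonglongrightarrow> L" "L \<noteq> 0"
  shows "((\<lambda>\<pi>. x ^ sum_mset \<pi>) has_sum 1 / L) {\<pi>. set_mset \<pi> \<subseteq> S}"
proof -
  have fin: "((\<lambda>\<pi>. x ^ sum_mset \<pi>) has_sum (\<Prod>s\<in>F N. 1 / (1 - x ^ s))) {\<pi>. set_mset \<pi> \<subseteq> F N}" for N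
    using assms by (intro has_sum_multisets_finite) auto
  have lim: "(\<lambda>N. \<Prod>s\<in>F N. 1 / (1 - x ^ s)) \<longlonglongrightarrow> 1 / L"
    unfolding prod_dividef using L by (intro tendsto_intros) auto
  have le: "(\<Sum>\<pi>\<in>G. x ^ sum_mset \<pi>) \<le> 1 / L" if G: "finite G" "G \<subseteq> {\<pi>. set_mset \<pi> \<subseteq> S}" for G
  proof (rule tendsto_lowerbound[OF lim])
    have "eventually (\<lambda>N. (\<Union>\<pi>\<in>G. set_mset \<pi>) \<subseteq> F N) sequentially"
      using G by (intro F) auto
    then show "eventually (\<lambda>N. (\<Sum>\<pi>\<in>G. x ^ sum_mset \<pi>) \<le> (\<Prod>s\<in>F N. 1 / (1 - x ^ s))) sequentially"
    proof eventually_elim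
      case (elim N)
      then show ?case
        using x G by (intro finite_sum_le_has_sum[OF fin]) auto
    qed
  qed simp
  have "(\<lambda>\<pi>. x ^ sum_mset \<pi>) summable_on {\<pi>. set_mset \<pi> \<subseteq> S}"
    using x le by (intro nonneg_bdd_above_summable_on bdd_aboveI2[where M="1 / L"]) auto
  then obtain T where T: "((\<lambda>\<pi>. x ^ sum_mset \<pi>) has_sum T) {\<pi>. set_mset \<pi> \<subseteq> S}"
    by (auto simp: summable_on_def)
  have "T \<le> 1 / L" using T le by (rule has_sum_le_finite_sums)
  moreover have "1 / L \<le> T"
  proof (rule tendsto_upperbound[OF lim])
    have "(\<Prod>s\<in>F N. 1 / (1 - x ^ s)) \<le> T" for N
      using x F(2)[of N] by (intro has_sum_mono2[OF fin T]) auto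
    then show "eventually (\<lambda>N. (\<Prod>s\<in>F N. 1 / (1 - x ^ s)) \<le> T) sequentially" by simp
  qed simp
  ultimately show ?thesis using T by simp
qed

lemma has_sum_num_parts:
  fixes x :: real
  assumes "((\<lambda>\<pi>. x ^ sum_mset \<pi>) has_sum T) {\<pi>. set_mset \<pi> \<subseteq> S}" "0 \<notin> S"
  shows "((\<lambda>n. real (num_parts S n) * x ^ n) has_sum T) UNIV"
proof -
  let ?P = "\<lambda>n. {\<pi>. set_mset \<pi> \<subseteq> S \<and> sum_mset \<pi> = n}"
  have "((\<lambda>(n, \<pi>). x ^ n) has_sum T) (Sigma UNIV ?P)"
  proof -
    have "((\<lambda>\<pi>. x ^ sum_mset \<pi>) has_sum T) {\<pi>. set_mset \<pi> \<subseteq> S} = ((\<lambda>(n, \<pi>). x ^ n) has_sum T) (Sigma UNIV ?P)"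
      by (rule has_sum_reindex_bij_witness[where j="\<lambda>\<pi>. (sum_mset \<pi>, \<pi>)" and i=snd]) auto
    then show ?thesis using assms by simp
  qed
  then show ?thesis
  proof (rule has_sum_SigmaD)
    fix n
    show "((\<lambda>\<pi>. case (n, \<pi>) of (n, \<pi>) \<Rightarrow> x ^ n) has_sum real (num_parts S n) * x ^ n) (?P n)"
      using finite_parts[OF assms(2), of n] by (simp add: has_sum_finite_iff num_parts_def)
  qed
qed

text \<open>\<open>F N\<close> takes the first \<open>N\<close> members of every class, which turns
  the finite product into \<open>qpoch\<close> factors. Representatives in \<open>{1..m}\<close>
  keep 0 from being a part; \<open>r = m\<close> stands for the class of 0.\<close>

theorem partition_gf_residues:
  fixes x :: real
  assumes x: "0 < x" "x < 1" and R: "R \<subseteq> {1..m}" and m: "m > 0"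
  shows "((\<lambda>n. of_nat (num_parts {r + m * k | r k. r \<in> R} n) * complex_of_real x ^ n)
    has_sum 1 / (\<Prod>r\<in>R. qprod (of_real x ^ r) (of_real x ^ m))) UNIV"
proof -
  let ?x = "complex_of_real x"
  define S where "S = {r + m * k | r k. r \<in> R}"
  define F where "F N = (\<lambda>(r, k). r + m * k) ` (R \<times> {..<N})" for N
  have fR: "finite R" using R finite_subset by blast
  have S0: "0 \<notin> S" using R by (auto simp: S_def)
  have inj: "inj_on (\<lambda>(r, k). r + m * k) (R \<times> UNIV)"
  proof (rule inj_onI, clarify)
    fix r k r' k' assume *: "r \<in> R" "r' \<in> R" "r + m * k = r' + m * k'"
    then have "1 \<le> r" "r \<le> m" "1 \<le> r'" "r' \<le> m" using R by auto
    \<comment> \<open>Passing to \<open>r - 1 < m\<close> lets division by \<open>m\<close> recover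
      \<open>k\<close>.\<close>
    then obtain a a' where r: "r = Suc a" "r' = Suc a'" "a < m" "a' < m"
      by (metis One_nat_def Suc_le_D Suc_le_eq)
    then have "(a + m * k) div m = (a' + m * k') div m" using * by simp
    then have "k = k'" using r by simp
    then show "r = r' \<and> k = k'" using * by simp
  qed
  have prodF: "complex_of_real (\<Prod>s\<in>F N. 1 - x ^ s) = (\<Prod>r\<in>R. qpoch (?x ^ r) (?x ^ m) N)" for N
  proof -
    have "(\<Prod>s\<in>F N. 1 - ?x ^ s) = (\<Prod>(r, k)\<in>R \<times> {..<N}. 1 - ?x ^ (r + m * k))"
      unfolding F_def by (subst prod.reindex[OF inj_on_subset[OF inj]]) (auto simp: case_prod_unfold)
    also have "\<dots> = (\<Prod>r\<in>R. qpoch (?x ^ r) (?x ^ m) N)"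
      by (simp add: qpoch_def prod.cartesian_product power_add power_mult)
    finally show ?thesis by simp
  qed
  define C where "C = (\<Prod>r\<in>R. qprod (?x ^ r) (?x ^ m))"
  have nx: "norm ?x < 1" using x by simp
  have "(\<lambda>N. \<Prod>r\<in>R. qpoch (?x ^ r) (?x ^ m) N) \<longlonglongrightarrow> C"
    unfolding C_def using nx m by (intro tendsto_prod qpoch_tendsto norm_power_lt_1) auto
  then have lim: "(\<lambda>N. complex_of_real (\<Prod>s\<in>F N. 1 - x ^ s)) \<longlonglongrightarrow> C"
    by (simp only: prodF)
  have limR: "(\<lambda>N. \<Prod>s\<in>F N. 1 - x ^ s) \<longlonglongrightarrow> Re C"
    using tendsto_Re[OF lim] by (simp only: Re_complex_of_real)
  \<comment> \<open>A limit of real numbers is real; the monotonicity argument for multisets runs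
    over the reals.\<close>
  have CR: "C = of_real (Re C)"
    using LIMSEQ_unique[OF lim tendsto_of_real[OF limR]] by simp
  have "C \<noteq> 0"
  proof -
    have "qprod (?x ^ r) (?x ^ m) \<noteq> 0" if "r \<in> R" for r
      using R that nx m by (intro qprod_power_nonzero) auto
    then show ?thesis using fR by (simp add: C_def)
  qed
  then have "Re C \<noteq> 0" using CR by auto
  have "((\<lambda>\<pi>. x ^ sum_mset \<pi>) has_sum 1 / Re C) {\<pi>. set_mset \<pi> \<subseteq> S}"
  proof (rule has_sum_multisets[where F=F])
    fix K assume K: "finite K" "K \<subseteq> S"
    show "eventually (\<lambda>N. K \<subseteq> F N) sequentially"
      unfolding eventually_sequentially
    proof (intro exI allI impI subsetI)
      fix N s assume N: "Suc (Max K) \<le> N" and s: "s \<in> K"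
      then obtain r k where rk: "s = r + m * k" "r \<in> R" using K by (auto simp: S_def)
      have "k \<le> m * k" using m by simp
      also have "\<dots> \<le> Max K" using Max_ge[OF K(1) s] rk by simp
      finally have "k < N" using N by simp
      then show "s \<in> F N" using rk by (auto simp: F_def)
    qed
  qed (use x S0 fR limR \<open>Re C \<noteq> 0\<close> in \<open>auto simp: F_def S_def\<close>)
  then have "((\<lambda>n. real (num_parts S n) * x ^ n) has_sum 1 / Re C) UNIV"
    using S0 by (rule has_sum_num_parts)
  then have "((\<lambda>n. complex_of_real (real (num_parts S n) * x ^ n)) has_sum complex_of_real (1 / Re C)) UNIV"
    by (rule has_sum_of_real)
  then show ?thesis
    using CR by (simp add: S_def C_def)
qed

section \<open>Partitions by minimal excludant\<close>

definition prog_sum :: "nat \<Rightarrow> nat \<Rightarrow> nat \<Rightarrow> nat" where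
  "prog_sum A a j = (\<Sum>i<j. a + i * A)"

lemma le_prog_sum: "a > 0 \<Longrightarrow> j \<le> prog_sum A a j"
  by (induction j) (auto simp: prog_sum_def)

text \<open>If the mex is \<open>a + J * A\<close>, the congruence says that \<open>J\<close> is
  even, and 1 - 1 + ... up to \<open>j = J\<close> is the indicator of that. Swapping sums reduces
  the claim to counting partitions that contain the first \<open>j\<close> terms.\<close>

lemma int_p_mex_eq:
  assumes "A > 0" "a > 0"
  shows "int (p_mex A a (int n)) =
    (\<Sum>j\<in>{j. prog_sum A a j \<le> n}. (- 1) ^ j * int (num_parts {0<..} (n - prog_sum A a j)))"
proof -
  define P where "P n = {\<pi>. set_mset \<pi> \<subseteq> {0<..} \<and> sum_mset \<pi> = n}" for n :: nat
  have finP: "finite (P n)" for n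
    unfolding P_def by (rule finite_parts) simp
  \<comment> \<open>Each term occurs once, so \<open>B j \<subseteq># \<pi>\<close> says just that
    the first \<open>j\<close> terms are parts, with any multiplicity.\<close>
  define B where "B j = mset_set ((\<lambda>i. a + i * A) ` {..<j})" for j
  have inj: "inj_on (\<lambda>i. a + i * A) X" for X
    using assms by (auto simp: inj_on_def)
  have sumB: "sum_mset (B j) = prog_sum A a j" for j
  proof -
    have "sum_mset (B j) = (\<Sum>x\<in>(\<lambda>i. a + i * A) ` {..<j}. x)"
      unfolding B_def sum_unfold_sum_mset by simp
    then show ?thesis by (simp add: sum.reindex[OF inj] prog_sum_def)
  qed
  have B_subset: "B j \<subseteq># \<pi> \<longleftrightarrow> (\<forall>i<j. a + i * A \<in># \<pi>)" for j \<pi>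
  proof
    assume "B j \<subseteq># \<pi>"
    then have "set_mset (B j) \<subseteq> set_mset \<pi>" by (rule set_mset_mono)
    then show "\<forall>i<j. a + i * A \<in># \<pi>" by (auto simp: B_def)
  next
    assume "\<forall>i<j. a + i * A \<in># \<pi>"
    then show "B j \<subseteq># \<pi>"
      by (intro mset_subset_eqI) (auto simp: B_def count_mset_set' Suc_le_eq)
  qed
  have B_pos: "set_mset (B j) \<subseteq> {0<..}" for j
    using assms by (auto simp: B_def)
  \<comment> \<open>Remove the first \<open>j\<close> terms of the progression.\<close>
  have card_B: "card {\<pi> \<in> P n. B j \<subseteq># \<pi>} = (if prog_sum A a j \<le> n then num_parts {0<..} (n - prog_sum A a j) else 0)" for j
  proof (cases "prog_sum A a j \<le> n")
    case True
    have "bij_betw (\<lambda>\<pi>. \<pi> - B j) {\<pi> \<in> P n. B j \<subseteq># \<pi>} (P (n - prog_sum A a j))"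
    proof (rule bij_betwI[where g="\<lambda>\<pi>. \<pi> + B j"])
      show "(\<lambda>\<pi>. \<pi> - B j) \<in> {\<pi> \<in> P n. B j \<subseteq># \<pi>} \<rightarrow> P (n - prog_sum A a j)"
        by (auto simp: P_def sum_mset_diff sumB dest: in_diffD)
      show "(\<lambda>\<pi>. \<pi> + B j) \<in> P (n - prog_sum A a j) \<rightarrow> {\<pi> \<in> P n. B j \<subseteq># \<pi>}"
        using True B_pos[of j] by (auto simp: P_def sumB)
    qed auto
    then show ?thesis
      using True bij_betw_same_card by (fastforce simp: num_parts_def P_def)
  next
    case False
    have "\<not> B j \<subseteq># \<pi>" if "\<pi> \<in> P n" for \<pi>
    proof
      assume "B j \<subseteq># \<pi>"
      then have "\<pi> = B j + (\<pi> - B j)" by simp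
      then have "sum_mset \<pi> = prog_sum A a j + sum_mset (\<pi> - B j)" by (metis sumB sum_mset.union)
      then show False using that False by (simp add: P_def)
    qed
    then have "{\<pi> \<in> P n. B j \<subseteq># \<pi>} = {}" by blast
    then show ?thesis using False by (metis card.empty)
  qed
  \<comment> \<open>If \<open>mex A a \<pi> = a + J * A\<close>, then the nonzero terms on the right are those with \<open>j \<le> J\<close>.\<close>
  have ind: "(if [mex A a \<pi> = a] (mod (2 * A)) then 1 else 0 :: int) = (\<Sum>j\<le>n. if B j \<subseteq># \<pi> then (- 1) ^ j else 0)"
    if \<pi>: "\<pi> \<in> P n" for \<pi>
  proof -
    have "\<exists>k. a + k * A \<notin># \<pi>"
    proof (rule ccontr)
      assume "\<not> ?thesis"
      then have "range (\<lambda>k. a + k * A) \<subseteq> set_mset \<pi>" by auto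
      then have "finite (range (\<lambda>k. a + k * A))" using finite_subset by blast
      then show False using finite_imageD[OF _ inj] infinite_UNIV_nat by blast
    qed
    define J where "J = (LEAST k. a + k * A \<notin># \<pi>)"
    have J: "a + J * A \<notin># \<pi>" unfolding J_def using \<open>\<exists>k. _\<close> by (rule LeastI_ex)
    have J_less: "a + i * A \<in># \<pi>" if "i < J" for i
      using not_less_Least that unfolding J_def by blast
    have mexJ: "mex A a \<pi> = a + J * A"
      unfolding mex_def
    proof (rule Least_equality)
      show "a + J * A \<in> range (\<lambda>k. a + k * A) \<and> a + J * A \<notin># \<pi>" using J by auto
      fix y assume "y \<in> range (\<lambda>k. a + k * A) \<and> y \<notin># \<pi>"
      then show "a + J * A \<le> y" using J_less by (fastforce simp: not_less[symmetric])
    qed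
    have "[mex A a \<pi> = a] (mod (2 * A)) \<longleftrightarrow> even J"
    proof -
      have "[mex A a \<pi> = a] (mod (2 * A)) \<longleftrightarrow> [J * A = 0] (mod (2 * A))"
        unfolding mexJ by (rule cong_add_lcancel_0_nat)
      also have "\<dots> \<longleftrightarrow> 2 * A dvd J * A" by (rule cong_0_iff)
      also have "\<dots> \<longleftrightarrow> even J" using assms by simp
      finally show ?thesis .
    qed
    moreover have "(\<Sum>j\<le>n. if B j \<subseteq># \<pi> then (- 1) ^ j else 0) = (\<Sum>j\<le>J. (- 1 :: int) ^ j)"
    proof -
      have iff: "B j \<subseteq># \<pi> \<longleftrightarrow> j \<le> J" for j
        unfolding B_subset using J J_less by (meson le_less_trans not_less order_less_le_trans)
      have "J \<le> n"
      proof -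
        \<comment> \<open>\<open>\<pi>\<close> itself contains \<open>B J\<close>, so
          \<open>card_B\<close> forces \<open>prog_sum A a J \<le> n\<close>.\<close>
        have "card {\<pi>' \<in> P n. B J \<subseteq># \<pi>'} \<noteq> 0"
          using \<pi> iff finP by auto
        then have "prog_sum A a J \<le> n" unfolding card_B by (auto split: if_splits)
        then show ?thesis using le_prog_sum[OF assms(2)] le_trans by blast
      qed
      then show ?thesis unfolding iff by (intro sum.mono_neutral_cong_right) auto
    qed
    moreover have "(\<Sum>j\<le>J. (- 1 :: int) ^ j) = (if even J then 1 else 0)"
      by (induction J) auto
    ultimately show ?thesis by simp
  qed
  have "{\<pi>. partition_of (int n) \<pi>} = P n"
    by (auto simp: partition_of_def P_def simp del: of_nat_sum_mset)
  then have "int (p_mex A a (int n)) = int (card {\<pi> \<in> P n. [mex A a \<pi> = a] (mod (2 * A))})"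
    unfolding p_mex_def by (metis (no_types, lifting) Collect_cong mem_Collect_eq)
  also have "\<dots> = (\<Sum>\<pi>\<in>P n. if [mex A a \<pi> = a] (mod (2 * A)) then 1 else 0)"
    using finP by (simp add: sum.If_cases Collect_conj_eq Int_commute)
  also have "\<dots> = (\<Sum>\<pi>\<in>P n. \<Sum>j\<le>n. if B j \<subseteq># \<pi> then (- 1) ^ j else 0)"
    by (rule sum.cong) (use ind in auto)
  also have "\<dots> = (\<Sum>j\<le>n. \<Sum>\<pi>\<in>P n. if B j \<subseteq># \<pi> then (- 1) ^ j else 0)"
    by (rule sum.swap)
  also have "\<dots> = (\<Sum>j\<le>n. (- 1) ^ j * int (card {\<pi> \<in> P n. B j \<subseteq># \<pi>}))"
    using finP by (intro sum.cong) (simp_all add: sum.If_cases Collect_conj_eq Int_commute mult.commute)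
  also have "\<dots> = (\<Sum>j\<in>{j. prog_sum A a j \<le> n}. (- 1) ^ j * int (num_parts {0<..} (n - prog_sum A a j)))"
    unfolding card_B
    by (intro sum.mono_neutral_cong_right) (auto intro: le_trans[OF le_prog_sum[OF assms(2)]])
  finally show ?thesis .
qed

text \<open>Cauchy product: the pair \<open>(j, m)\<close> contributes to
  \<open>n = m + prog_sum A a j\<close>, and collecting by \<open>n\<close> gives the sum in
  \<open>int_p_mex_eq\<close>.\<close>

lemma p_mex_gf:
  fixes x :: complex
  assumes x: "norm x < 1" and A: "A > 0" "a > 0"
    and P: "((\<lambda>n. of_nat (num_parts {0<..} n) * x ^ n) has_sum P) UNIV"
    and T: "((\<lambda>j. (- 1) ^ j * x ^ prog_sum A a j) has_sum T) UNIV"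
  shows "((\<lambda>n. of_nat (p_mex A a (int n)) * x ^ n) has_sum T * P) UNIV"
proof -
  let ?e = "prog_sum A a" and ?p = "num_parts {0<..}"
  have "((\<lambda>(j, m). ((- 1) ^ j * x ^ ?e j) * (of_nat (?p m) * x ^ m)) has_sum T * P) (UNIV \<times> UNIV)"
    using P T by (intro has_sum_mult_Times)
      (auto dest!: has_sum_imp_summable simp flip: summable_on_iff_abs_summable_on_complex)
  also have "?this \<longleftrightarrow> ((\<lambda>(n, j). ((- 1) ^ j * of_nat (?p (n - ?e j))) * x ^ n) has_sum T * P) (Sigma UNIV (\<lambda>n. {j. ?e j \<le> n}))"
    by (rule has_sum_reindex_bij_witness[where j="\<lambda>(j, m). (m + ?e j, j)" and i="\<lambda>(n, j). (j, n - ?e j)"])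
       (auto simp: power_add)
  finally show ?thesis
  proof (rule has_sum_SigmaD)
    fix n
    have "finite {j. ?e j \<le> n}"
      by (rule finite_subset[of _ "{..n}"]) (auto intro: le_trans[OF le_prog_sum[OF A(2)]])
    moreover have "complex_of_int (int (p_mex A a (int n))) = (\<Sum>j\<in>{j. ?e j \<le> n}. (- 1) ^ j * of_nat (?p (n - ?e j)))"
      unfolding int_p_mex_eq[OF A] by simp
    ultimately show "((\<lambda>j. case (n, j) of (n, j) \<Rightarrow> ((- 1) ^ j * of_nat (?p (n - ?e j))) * x ^ n)
        has_sum of_nat (p_mex A a (int n)) * x ^ n) {j. ?e j \<le> n}"
      by (simp add: has_sum_finite_iff sum_distrib_right)
  qed
qed

text \<open>Reflection identifies the negative half with the positive half, so the latter is half of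
  what remains without the term at 0.\<close>

lemma has_sum_even_int:
  fixes f :: "int \<Rightarrow> complex"
  assumes f: "(f has_sum S) UNIV" and even: "\<And>j. f (- j) = f j"
  shows "((\<lambda>j. f (int j + 1)) has_sum (S - f 0) / 2) UNIV"
proof -
  have sub: "f summable_on X" for X
    using f has_sum_imp_summable summable_on_subset by blast
  define T where "T = infsum f {0<..}"
  have T: "(f has_sum T) {0<..}" unfolding T_def using sub by (rule has_sum_infsum)
  have T': "(f has_sum T) {..<0}"
  proof -
    have "(f has_sum T) {..<0} = (f has_sum T) {0<..}"
      by (rule has_sum_reindex_bij_witness[where i=uminus and j=uminus]) (auto simp: even)
    then show ?thesis using T by simp
  qed
  have "(f has_sum (f 0 + T + T)) (({0} \<union> {0<..}) \<union> {..<0})"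
    using T T' by (intro has_sum_Un_disjoint) (auto simp: has_sum_finite_iff)
  moreover have "({0} \<union> {0<..}) \<union> {..<0} = (UNIV :: int set)" by auto
  ultimately have "S = f 0 + T + T" using f has_sum_unique by metis
  then have "T = (S - f 0) / 2" by simp
  moreover have "((\<lambda>j. f (int j + 1)) has_sum T) UNIV = (f has_sum T) {0<..}"
    by (rule has_sum_reindex_bij_witness[where i="\<lambda>j. nat (j - 1)" and j="\<lambda>j. int j + 1"]) auto
  ultimately show ?thesis using T by metis
qed

section \<open>Comparing coefficients of power series on (0, 1)\<close>

text \<open>Continuity at 0: the values vanish on (0, 1), while their limit from the right is
  \<open>c 0\<close>. Convergence at 1/2 provides a disc.\<close>

lemma sums_zero_imp_head_zero:
  fixes c :: "nat \<Rightarrow> complex"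
  assumes c: "\<And>x::real. 0 < x \<Longrightarrow> x < 1 \<Longrightarrow> (\<lambda>n. c n * of_real x ^ n) sums 0"
  shows "c 0 = 0"
proof -
  have "summable (\<lambda>n. c n * z ^ n)" if "norm z < 1 / 2" for z
    using powser_inside[of c "of_real (1 / 2)" z] c[of "1 / 2"] that by (simp add: sums_iff)
  then have "((\<lambda>z. \<Sum>n. c n * z ^ n) \<longlongrightarrow> c 0) (at 0)"
    by (intro powser_limit_0[of "1 / 2"]) (auto simp: summable_sums)
  moreover have "filterlim complex_of_real (at 0) (at_right 0)"
    by (intro filterlim_atI) (auto simp: eventually_at_filter intro!: tendsto_eq_intros)
  ultimately have "((\<lambda>x. \<Sum>n. c n * of_real x ^ n) \<longlongrightarrow> c 0) (at_right 0)"
    by (rule filterlim_compose)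
  moreover have "eventually (\<lambda>x::real. (\<Sum>n. c n * of_real x ^ n) = 0) (at_right 0)"
    unfolding eventually_at_right_field using c sums_unique by (intro exI[of _ 1]) fastforce
  ultimately have "((\<lambda>x::real. 0) \<longlongrightarrow> c 0) (at_right 0)"
    by (rule Lim_transform_eventually)
  then show ?thesis by (simp add: tendsto_const_iff)
qed

text \<open>Once \<open>c 0 = 0\<close>, dividing by \<open>x\<close> shifts the coefficients and
  preserves the hypothesis.\<close>

lemma sums_zero_imp_coeff_zero:
  fixes c :: "nat \<Rightarrow> complex"
  assumes "\<And>x::real. 0 < x \<Longrightarrow> x < 1 \<Longrightarrow> (\<lambda>n. c n * of_real x ^ n) sums 0"
  shows "c n = 0"
  using assms
proof (induction n arbitrary: c)
  case 0
  then show ?case by (rule sums_zero_imp_head_zero)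
next
  case (Suc n)
  have c0: "c 0 = 0" using Suc.prems by (rule sums_zero_imp_head_zero)
  show ?case
  proof (rule Suc.IH)
    fix x :: real assume x: "0 < x" "x < 1"
    have "(\<lambda>n. c (Suc n) * of_real x ^ Suc n) sums 0"
      using Suc.prems[OF x] c0 by (subst sums_Suc_iff) simp
    then have "(\<lambda>n. c (Suc n) * of_real x ^ Suc n / of_real x) sums (0 / of_real x)"
      by (rule sums_divide)
    then show "(\<lambda>n. c (Suc n) * of_real x ^ n) sums 0"
      using x by simp
  qed
qed

section \<open>Assembly of the identity\<close>

text \<open>To base \<open>q ^ 24\<close> the first factors carry the exponents 3, 9, 15, 21; 12,
  24; 5, 17; 7, 19; 22; 2. With the twelve listed residues these are 1 to 24, each once.\<close>

lemma residue_product: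
  fixes q :: complex
  assumes q: "norm q < 1"
  shows "qprod (q ^ 3) (q ^ 6) * (qprod (q ^ 12) (q ^ 12) * qprod (q ^ 5) (q ^ 12) * qprod (q ^ 7) (q ^ 12) *
      qprod (q ^ 22) (q ^ 24) * qprod (q ^ 2) (q ^ 24)) *
    (\<Prod>r\<in>{1, 4, 6, 8, 10, 11, 13, 14, 16, 18, 20, 23}. qprod (q ^ r) (q ^ 24)) = qprod q q"
proof -
  have dissect: "qprod (q ^ r) (q ^ l) = (\<Prod>j<d. qprod (q ^ (r + l * j)) (q ^ 24))" if "l * d = 24" for r l d
  proof -
    have "l > 0" "d > 0" using that by (auto intro!: Nat.gr0I)
    then show ?thesis
      using qprod_dissect[of "q ^ l" d "q ^ r"] q that
      by (simp add: norm_power_lt_1 flip: power_mult power_add)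
  qed
  show ?thesis
    using dissect[of 1 24 1] dissect[of 6 4 3] dissect[of 12 2 12] dissect[of 12 2 5] dissect[of 12 2 7]
    by (simp add: eval_nat_numeral mult_ac)
qed

text \<open>The terms of positive index in \<phi>(-y), divided by \<open>- y\<close>; the exponent
  becomes (j + 1)^2 - 1 = j (j + 2).\<close>

lemma one_sided_theta_square:
  fixes y :: complex
  assumes y: "y \<noteq> 0" "norm y < 1"
  shows "((\<lambda>j. (- 1) ^ j * y ^ (j * (j + 2))) has_sum (1 - qprod y y * qprod y (y\<^sup>2)) / (2 * y)) UNIV"
proof -
  let ?f = "\<lambda>j :: int. (if even j then 1 else - 1) * y powi (j\<^sup>2)"
  have "((\<lambda>j. ?f (int j + 1)) has_sum (qprod y y * qprod y (y\<^sup>2) - ?f 0) / 2) UNIV"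
    using theta_square[OF y] by (rule has_sum_even_int) auto
  then have "((\<lambda>j. - ?f (int j + 1) / y) has_sum - ((qprod y y * qprod y (y\<^sup>2) - ?f 0) / 2) / y) UNIV"
    by (intro has_sum_divide_const has_sum_uminusI)
  moreover have "- ?f (int j + 1) / y = (- 1) ^ j * y ^ (j * (j + 2))" for j :: nat
  proof -
    have "(int j + 1)\<^sup>2 = int (Suc (j * (j + 2)))" by (simp add: algebra_simps power2_eq_square)
    then have "y powi (int j + 1)\<^sup>2 = y * y ^ (j * (j + 2))" by (metis power_Suc power_int_of_nat)
    then show ?thesis using y by (simp add: minus_one_power_iff)
  qed
  moreover have "- ((qprod y y * qprod y (y\<^sup>2) - ?f 0) / 2) / y = (1 - qprod y y * qprod y (y\<^sup>2)) / (2 * y)"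
    using y by (simp add: field_simps)
  ultimately show ?thesis by simp
qed

lemma mem_residues_iff:
  fixes x :: nat
  shows "x \<in> {r + 24 * k | r k. r \<in> {1, 4, 6, 8, 10, 11, 13, 14, 16, 18, 20, 23}} \<longleftrightarrow>
    (\<exists>j \<in> {1, 4, 6, 8, 10, 11}. [int x = j] (mod 24) \<or> [int x = - j] (mod 24))" (is "x \<in> ?S \<longleftrightarrow> ?C")
proof -
  have "x \<in> ?S \<longleftrightarrow> x mod 24 \<in> {1, 4, 6, 8, 10, 11, 13, 14, 16, 18, 20, 23}"
  proof
    assume "x mod 24 \<in> {1, 4, 6, 8, 10, 11, 13, 14, 16, 18, 20, 23}"
    moreover have "x = x mod 24 + 24 * (x div 24)" by simp
    ultimately show "x \<in> ?S" by blast
  qed auto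
  also have "\<dots> \<longleftrightarrow> int x mod 24 \<in> {1, 4, 6, 8, 10, 11, 13, 14, 16, 18, 20, 23}"
  proof -
    have "int x mod 24 = int (x mod 24)" by (simp add: zmod_int)
    then show ?thesis by simp
  qed
  also have "\<dots> \<longleftrightarrow> ?C"
    by (simp add: unique_euclidean_semiring_class.cong_def) blast
  finally show ?thesis .
qed

lemma p_mex_difference_gf:
  fixes x :: real
  assumes x: "0 < x" "x < 1"
  defines "R \<equiv> {1, 4, 6, 8, 10, 11, 13, 14, 16, 18, 20, 23 :: nat}"
  shows "((\<lambda>n. (of_nat (p_mex 2 3 (int n)) - of_nat (p_mex 6 9 (int n - 2)) - of_nat (num_parts {r + 24 * k | r k. r \<in> R} n))
     * complex_of_real x ^ n) has_sum 0) UNIV"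
proof -
  define q where "q = complex_of_real x"
  have q: "q \<noteq> 0" "norm q < 1" using x by (auto simp: q_def)
  have q3: "q ^ 3 \<noteq> 0" "norm (q ^ 3) < 1" using q by (auto intro: norm_power_lt_1)
  define E where "E y = qprod y y * qprod y (y\<^sup>2)" for y
  define D where "D = qprod q q"
  define C where "C = (\<Prod>r\<in>R. qprod (q ^ r) (q ^ 24))"
  define K where "K = qprod (q ^ 3) (q ^ 6) * (qprod (q ^ 12) (q ^ 12) * qprod (q ^ 5) (q ^ 12) * qprod (q ^ 7) (q ^ 12) *
      qprod (q ^ 22) (q ^ 24) * qprod (q ^ 2) (q ^ 24))"
  have "D \<noteq> 0" using qprod_power_nonzero[OF q(2), of 1 1] by (simp add: D_def)
  have KC: "K * C = D" using residue_product[OF q(2)] by (simp only: K_def C_def D_def R_def)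
  have EK: "E (q ^ 3) - E q = 2 * q * K"
  proof -
    \<comment> \<open>\<open>sqrt x\<close> serves as the nome in
      \<open>theta_difference\<close>.\<close>
    have "complex_of_real (sqrt x) \<noteq> 0" "norm (complex_of_real (sqrt x)) < 1" "q = (complex_of_real (sqrt x))\<^sup>2"
      using x by (auto simp: q_def simp flip: of_real_power)
    from theta_difference[OF this] show ?thesis
      by (simp add: E_def K_def mult.assoc flip: power_mult)
  qed
  \<comment> \<open>The positive integers are the class of 1 modulo 1, so the generating function of
    all partitions is 1 / (q;q).\<close>
  have "{0<..} = {r + 1 * k | r k. r \<in> {1::nat}}"
    by (auto simp: gr0_conv_Suc)
  then have P: "((\<lambda>n. of_nat (num_parts {0<..} n) * q ^ n) has_sum 1 / D) UNIV"
    using partition_gf_residues[OF x, of "{1}" 1] by (simp add: q_def D_def)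
  have PS: "((\<lambda>n. of_nat (num_parts {r + 24 * k | r k. r \<in> R} n) * q ^ n) has_sum 1 / C) UNIV"
    using partition_gf_residues[OF x, of R 24] by (simp add: q_def C_def R_def)
  have e23: "prog_sum 2 3 j = j * (j + 2)" and e69: "prog_sum 6 9 j = 3 * (j * (j + 2))" for j
    by (induction j) (auto simp: prog_sum_def)
  have G1: "((\<lambda>n. of_nat (p_mex 2 3 (int n)) * q ^ n) has_sum (1 - E q) / (2 * q) * (1 / D)) UNIV"
    using one_sided_theta_square[OF q] by (intro p_mex_gf q P) (simp_all add: e23 E_def)
  have "((\<lambda>n. of_nat (p_mex 6 9 (int n)) * q ^ n) has_sum (1 - E (q ^ 3)) / (2 * q ^ 3) * (1 / D)) UNIV"
  proof (rule p_mex_gf)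
    show "((\<lambda>j. (- 1) ^ j * q ^ prog_sum 6 9 j) has_sum (1 - E (q ^ 3)) / (2 * q ^ 3)) UNIV"
      using one_sided_theta_square[OF q3] by (simp only: e69 E_def power_mult[of q 3])
  qed (use q P in auto)
  then have "((\<lambda>n. q\<^sup>2 * (of_nat (p_mex 6 9 (int n)) * q ^ n)) has_sum q\<^sup>2 * ((1 - E (q ^ 3)) / (2 * q ^ 3) * (1 / D))) UNIV"
    by (rule has_sum_cmult_right)
  also have "?this \<longleftrightarrow> ((\<lambda>n. of_nat (p_mex 6 9 (int n - 2)) * q ^ n) has_sum q\<^sup>2 * ((1 - E (q ^ 3)) / (2 * q ^ 3) * (1 / D))) {2..}"
    by (rule has_sum_reindex_bij_witness[where i="\<lambda>n. n - 2" and j="\<lambda>n. n + 2"])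
       (auto simp: power_add power2_eq_square)
  \<comment> \<open>The terms with \<open>n < 2\<close> vanish by \<open>p_mex_neg\<close>.\<close>
  also have "\<dots> \<longleftrightarrow> ((\<lambda>n. of_nat (p_mex 6 9 (int n - 2)) * q ^ n) has_sum q\<^sup>2 * ((1 - E (q ^ 3)) / (2 * q ^ 3) * (1 / D))) UNIV"
    by (rule has_sum_cong_neutral) (auto simp: p_mex_neg)
  finally have G2: "((\<lambda>n. of_nat (p_mex 6 9 (int n - 2)) * q ^ n) has_sum q\<^sup>2 * ((1 - E (q ^ 3)) / (2 * q ^ 3) * (1 / D))) UNIV" .
  \<comment> \<open>Since q^2 / (2 q^3) = 1 / (2 q), the shift by 2 cancels the two constants 1.
    What remains of the first two terms is \<open>K / D\<close>, which is \<open>1 / C\<close> by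
    \<open>KC\<close>.\<close>
  have "(1 - E q) / (2 * q) * (1 / D) - q\<^sup>2 * ((1 - E (q ^ 3)) / (2 * q ^ 3) * (1 / D)) - 1 / C = 
      (E (q ^ 3) - E q) / (2 * q * D) - 1 / C"
    using q(1) \<open>D \<noteq> 0\<close> by (simp add: field_simps power2_eq_square power3_eq_cube)
  also have "\<dots> = K / D - 1 / C" unfolding EK using q(1) by simp
  also have "\<dots> = 0" using KC \<open>D \<noteq> 0\<close> by (auto simp: field_simps)
  finally have 0: "(1 - E q) / (2 * q) * (1 / D) + - (q\<^sup>2 * ((1 - E (q ^ 3)) / (2 * q ^ 3) * (1 / D))) + - (1 / C) = 0" by simp
  show ?thesis
    using has_sum_add[OF has_sum_add[OF G1 has_sum_uminusI[OF G2]] has_sum_uminusI[OF PS]]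
    unfolding 0 by (simp add: q_def algebra_simps)
qed

theorem theorem3p12:
  fixes n :: nat
  shows "int (p_mex 2 3 (int n)) - int (p_mex 6 9 (int n - 2)) =
    int (card {\<pi>. partition_of (int n) \<pi> \<and>
      (\<forall>x \<in># \<pi>. \<exists>j \<in> {1, 4, 6, 8, 10, 11}. [int x = j] (mod 24) \<or> [int x = - j] (mod 24))})"
proof -
  let ?S = "{r + 24 * k | r k. r \<in> {1, 4, 6, 8, 10, 11, 13, 14, 16, 18, 20, 23 :: nat}}"
  have "complex_of_int (int (p_mex 2 3 (int n)) - int (p_mex 6 9 (int n - 2)) - int (num_parts ?S n)) = 0"
    using sums_zero_imp_coeff_zero[OF has_sum_imp_sums[OF p_mex_difference_gf], of n] by simp
  then have *: "int (p_mex 2 3 (int n)) - int (p_mex 6 9 (int n - 2)) = int (num_parts ?S n)"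
    by (simp only: of_int_eq_0_iff)
  have "{\<pi>. set_mset \<pi> \<subseteq> ?S \<and> sum_mset \<pi> = n} = {\<pi>. partition_of (int n) \<pi> \<and>
      (\<forall>x \<in># \<pi>. \<exists>j \<in> {1, 4, 6, 8, 10, 11}. [int x = j] (mod 24) \<or> [int x = - j] (mod 24))}"
  proof -
    \<comment> \<open>Membership in \<open>?S\<close> already forces positive parts, as
      \<open>partition_of\<close> demands.\<close>
    have "0 \<notin> ?S" by auto
    then have "set_mset \<pi> \<subseteq> ?S \<longleftrightarrow> (\<forall>x \<in># \<pi>. 0 < x) \<and> (\<forall>x \<in># \<pi>. x \<in> ?S)" for \<pi>
      by (metis (no_types, lifting) gr0I subsetI subset_iff)
    then show ?thesis
      unfolding mem_residues_iff partition_of_def by (auto simp del: of_nat_sum_mset)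
  qed
  then have "num_parts ?S n = card {\<pi>. partition_of (int n) \<pi> \<and>
      (\<forall>x \<in># \<pi>. \<exists>j \<in> {1, 4, 6, 8, 10, 11}. [int x = j] (mod 24) \<or> [int x = - j] (mod 24))}"
    unfolding num_parts_def by simp
  with * show ?thesis by simp
qed

end
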